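(* Let $H\in\mathbb{C}^{n\times n}$ be an invertible Hermitian matrix and let $B\in\mathbb{C}^{n\times n}$ be an $H$-nonnegative matrix with no negative eigenvalues and no Jordan blocks of size two at the eigenvalue zero, such that $(B,H)$ is in canonical form $$B=\bigoplus_{i=1}^qJ_1(\lambda_i)\oplus\bigoplus_{i=1}^sJ_1(0),\qquad H=\bigoplus_{i=1}^qQ_1\oplus\bigoplus_{i=1}^s\varepsilon_iQ_1,$$ with $\lambda_i>0$ and $\varepsilon_i=\pm1$. Let $A$ be an $H$-nonnegative square root of $B$. Then there is a Segre pairing $\mathcal{S}$ of $B$, with $\ell_1$ pairs $(1,0)$ and $\ell_2$ pairs $(1,1)$, such that the canonical form of the pair $(A,H)$ is $$P^{-1}AP=\bigoplus_{i=1}^qJ_1(\sqrt{\lambda_i})\oplus\bigoplus_{i=1}^{\ell_1}J_1(0)\oplus\bigoplus_{i=1}^{\ell_2}J_2(0),$$ $$P^*HP=\bigoplus_{i=1}^qQ_1\oplus\bigoplus_{i=1}^{\ell_1}\zeta_iQ_1\oplus\bigoplus_{i=1}^{\ell_2}Q_2,$$ for some invertible matrix $P$, where $\zeta_i$ is equal to the sign characteristic of the corresponding block $J_1(0)$ in $B$ (that is, $\zeta_i=\varepsilon_{\iota(i)}$ for some injective map $\iota:\{1,\ldots,\ell_1\}\to\{1,\ldots,s\}$, with $\iota(i)$ the index of the block of $B$ corresponding to the $i$-th pair $(1,0)$).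
   Context: With $(\cdot,\cdot)$ the Euclidean inner product on $\mathbb{C}^n$ and $[x,y]=(Hx,y)$: a matrix $B$ is $H$-nonnegative if $[Bx,x]\ge 0$ for all $x\in\mathbb{C}^n$. An $H$-nonnegative square root of $B$ is an $H$-nonnegative matrix $A$ with $A^2=B$. $J_k(\lambda)$ is the $k\times k$ Jordan block with eigenvalue $\lambda$; $Q_k$ is the $k\times k$ matrix with ones on the main anti-diagonal and zeros elsewhere. Canonical form of a pair $(A,H)$ with $HA=A^*H$ and $A$ having real spectrum: there is an invertible $P$ with $P^{-1}AP=\bigoplus_jJ_{k_j}(\mu_j)$ and $P^*HP=\bigoplus_j\theta_jQ_{k_j}$, $\theta_j=\pm1$ (the sign characteristic); it is unique up to simultaneous permutation of blocks. A Segre pairing of $B$ (whose Jordan blocks at $0$ are $s$ blocks of size one) is a finite collection of pairs $(1,1)$ and $(1,0)$, with repetitions allowed and arranged lexicographically, such that each of the $s$ block sizes $1$ appears in one and only one pair; thus $\ell_1+2\ell_2=s$. *)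

theory Defs
  imports
    "Jordan_Normal_Form.Jordan_Normal_Form"
    "Jordan_Normal_Form.Schur_Decomposition"
begin

text \<open>Matrices and vectors are the carrier-based ones of \<^theory>\<open>Jordan_Normal_Form.Matrix\<close>.
  The product \<^term>\<open>x \<bullet>c y\<close> is linear in the first argument and conjugate-linear in the second.\<close>

definition indef_inner :: "complex mat \<Rightarrow> complex vec \<Rightarrow> complex vec \<Rightarrow> complex" where
  "indef_inner H x y = (H *\<^sub>v x) \<bullet>c y"

text \<open>The order on the complex numbers is the partial one, for which \<^term>\<open>0 \<le> (z :: complex)\<close>
  says that \<^term>\<open>z\<close> is real and nonnegative.\<close>

definition H_nonneg :: "complex mat \<Rightarrow> complex mat \<Rightarrow> bool" where
  "H_nonneg H B \<longleftrightarrow>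
     B \<in> carrier_mat (dim_row H) (dim_row H) \<and>
     (\<forall>x \<in> carrier_vec (dim_row H). 0 \<le> indef_inner H (B *\<^sub>v x) x)"

definition H_nonneg_sqrt :: "complex mat \<Rightarrow> complex mat \<Rightarrow> complex mat \<Rightarrow> bool" where
  "H_nonneg_sqrt H B A \<longleftrightarrow> H_nonneg H A \<and> A ^\<^sub>m 2 = B"

definition Q_mat :: "nat \<Rightarrow> complex mat" where
  "Q_mat k = mat k k (\<lambda>(i, j). if i + j + 1 = k then 1 else 0)"

text \<open>The counterpart of \<^const>\<open>jordan_matrix\<close> for the second matrix of a pair in canonical
  form: the list contains the block sizes together with the signs.\<close>

definition sign_matrix :: "(nat \<times> real) list \<Rightarrow> complex mat" where
  "sign_matrix k_\<theta>s = diag_block_mat (map (\<lambda>(k, \<theta>). complex_of_real \<theta> \<cdot>\<^sub>m Q_mat k) k_\<theta>s)"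

definition zero_block_sizes :: "(nat \<times> complex) list \<Rightarrow> nat list" where
  "zero_block_sizes bs = map fst (filter (\<lambda>(k, a). a = 0) bs)"

text \<open>A slot of a list of pairs is a position in the list together with a coordinate (0 or 1).
  Only slots with a nonzero entry hold a block: the 0 of a pair (1,0) is a placeholder.\<close>

definition slot_entry :: "(nat \<times> nat) list \<Rightarrow> nat \<times> nat \<Rightarrow> nat" where
  "slot_entry S = (\<lambda>(k, c). if c = 0 then fst (S ! k) else snd (S ! k))"

definition slots :: "(nat \<times> nat) list \<Rightarrow> (nat \<times> nat) set" where
  "slots S = {(k, c). k < length S \<and> c < 2 \<and> slot_entry S (k, c) \<noteq> 0}"

text \<open>The map \<open>\<sigma>\<close> says which of the blocks at 0 (numbered from 0 in the order in which they occur
  in \<open>bs\<close>) sits in which slot. Bijectivity says that each block appears in one and only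
  one pair.\<close>

definition segre_assignment ::
  "(nat \<times> complex) list \<Rightarrow> (nat \<times> nat) list \<Rightarrow> (nat \<times> nat \<Rightarrow> nat) \<Rightarrow> bool" where
  "segre_assignment bs S \<sigma> \<longleftrightarrow>
     bij_betw \<sigma> (slots S) {..<length (zero_block_sizes bs)} \<and>
     (\<forall>t \<in> slots S. zero_block_sizes bs ! \<sigma> t = slot_entry S t)"

definition lex_le :: "nat \<times> nat \<Rightarrow> nat \<times> nat \<Rightarrow> bool" where
  "lex_le p r \<longleftrightarrow> fst p < fst r \<or> (fst p = fst r \<and> snd p \<le> snd r)"

text \<open>Segre pairings of a matrix whose Jordan blocks at 0 all have size one. They are lists, so
  repetitions are allowed.\<close>

definition segre_pairing :: "complex mat \<Rightarrow> (nat \<times> nat) list \<Rightarrow> bool" where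
  "segre_pairing B S \<longleftrightarrow>
     set S \<subseteq> {(1, 1), (1, 0)} \<and> sorted_wrt lex_le S \<and>
     (\<exists>bs \<sigma>. jordan_nf B bs \<and> segre_assignment bs S \<sigma>)"

text \<open>The position in \<open>S\<close> of the \<open>i\<close>-th pair (1,0), counted from 0.\<close>

definition single_pos :: "(nat \<times> nat) list \<Rightarrow> nat \<Rightarrow> nat" where
  "single_pos S i = filter (\<lambda>k. S ! k = (1, 0)) [0..<length S] ! i"

end

theory Submission
  imports Defs
begin

text \<open>
  Since \<open>A\<close> commutes with \<open>A\<^sup>2 = B\<close>, it respects the splitting of the space into the positive
  eigenspaces of \<open>B\<close> and its kernel. On the former \<open>H\<close> is the identity, so \<open>A\<close> is there the
  positive semidefinite square root of a diagonal matrix, hence diagonal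
  (\<open>eigenvector_of_nonneg_sqrt\<close>). On the kernel \<open>A\<^sup>2 = 0\<close>, and the whole argument is about the two
  forms \<open>h(x, y) = [x, y]\<close> and \<open>k(x, y) = [A x, y]\<close>, the second being positive semidefinite.

  If \<open>k\<close> vanishes on the kernel, then \<open>A = 0\<close> there and all blocks have size one. Otherwise some \<open>x\<close>
  has \<open>k(x, x) = 1\<close>. With \<open>e\<^sub>1 = A x\<close> one gets \<open>h(e\<^sub>1, e\<^sub>1) = h(A\<^sup>2 x, x) = 0\<close> and
  \<open>h(e\<^sub>1, x) = 1\<close>; a multiple of \<open>e\<^sub>1\<close> subtracted from \<open>x\<close> gives \<open>e\<^sub>2\<close> with \<open>h(e\<^sub>2, e\<^sub>2) = 0\<close>, and
  \<open>(e\<^sub>1, e\<^sub>2)\<close> is a Jordan chain whose Gram matrix under \<open>h\<close> is \<open>Q\<^sub>2\<close>. The plane it spans is hyperbolic: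
  it has an \<open>h\<close>-orthonormal basis of one positive vector \<open>u\<close> and one negative vector \<open>v\<close>.

  What makes the signs of the remaining blocks come out right is a form of Witt's theorem: a
  pseudo-orthonormal basis with given signs can be changed, by a quasi-reflection, into one with the
  same signs that contains a prescribed vector of square 1 or -1 (\<open>frame_exchange\<close>). Thus \<open>u\<close> and
  \<open>v\<close> take the places of two basis vectors of opposite signs, and the other vectors keep
  their signs and lie in the orthogonal complement of the plane, on which the argument is repeated
  (\<open>hyperbolic_frame_exists\<close>). In the end the index set of the kernel is divided into pairs of
  opposite signs, which are the pairs (1,1) of the Segre pairing, and single indices, which are the
  pairs (1,0); a single index carries its own sign, which is the claim on the sign characteristic.

  If \<open>P\<close> has the basis vectors so arranged as its columns, then \<open>P\<^sup>* H P\<close> and \<open>P\<^sup>* (H A) P\<close> are Gram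
  matrices, equal to \<open>S\<close> and \<open>S J\<close> for the sign matrix \<open>S\<close> and the Jordan matrix \<open>J\<close>. As \<open>S\<^sup>2 = 1\<close>,
  this gives \<open>P\<^sup>-\<^sup>1 A P = J\<close> (\<open>canonical_form_of_chains\<close>).
\<close>

section \<open>Sesquilinear forms given by matrices\<close>

lemma indef_inner_add_left:
  assumes "M \<in> carrier_mat n n" "x \<in> carrier_vec n" "y \<in> carrier_vec n" "z \<in> carrier_vec n"
  shows "indef_inner M (x + y) z = indef_inner M x z + indef_inner M y z"
  using assms unfolding indef_inner_def
  by (simp add: mult_add_distrib_mat_vec[of M n n] add_scalar_prod_distrib[of _ n])

lemma indef_inner_add_right:
  assumes "M \<in> carrier_mat n n" "x \<in> carrier_vec n" "y \<in> carrier_vec n" "z \<in> carrier_vec n"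
  shows "indef_inner M z (x + y) = indef_inner M z x + indef_inner M z y"
  using assms unfolding indef_inner_def
  by (simp add: conjugate_add_vec[of _ n] scalar_prod_add_distrib[of _ n])

lemma indef_inner_smult_left:
  assumes "M \<in> carrier_mat n n" "x \<in> carrier_vec n" "z \<in> carrier_vec n"
  shows "indef_inner M (c \<cdot>\<^sub>v x) z = c * indef_inner M x z"
  using assms unfolding indef_inner_def
  by (simp add: mult_mat_vec[of M n n])

lemma indef_inner_smult_right:
  assumes "M \<in> carrier_mat n n" "x \<in> carrier_vec n" "z \<in> carrier_vec n"
  shows "indef_inner M z (c \<cdot>\<^sub>v x) = cnj c * indef_inner M z x"
  using assms unfolding indef_inner_def
  by (simp add: conjugate_smult_vec)

lemmas indef_inner_linear = indef_inner_add_left indef_inner_add_right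
  indef_inner_smult_left indef_inner_smult_right

lemma indef_inner_alt:
  assumes "M \<in> carrier_mat n n" "x \<in> carrier_vec n" "y \<in> carrier_vec n"
  shows "indef_inner M x y = (\<Sum>i<n. \<Sum>j<n. M $$ (i, j) * x $ j * cnj (y $ i))"
proof -
  have "indef_inner M x y = (\<Sum>i<n. (\<Sum>j<n. M $$ (i, j) * x $ j) * cnj (y $ i))"
    using assms unfolding indef_inner_def
    by (auto simp: scalar_prod_def lessThan_atLeast0 intro!: sum.cong)
  then show ?thesis by (simp add: sum_distrib_right)
qed

lemma mat_adjoint_index:
  assumes "M \<in> carrier_mat n m" "i < m" "j < n"
  shows "(mat_adjoint M :: complex mat) $$ (i, j) = cnj (M $$ (j, i))"
  using assms unfolding mat_adjoint_def mat_of_rows_def by simp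

lemma mat_adjoint_carrier:
  assumes "M \<in> carrier_mat n m"
  shows "(mat_adjoint M :: complex mat) \<in> carrier_mat m n"
  using assms unfolding mat_adjoint_def mat_of_rows_def by simp

lemma indef_inner_hermitian:
  assumes M: "M \<in> carrier_mat n n" "mat_adjoint M = M"
    and "x \<in> carrier_vec n" "y \<in> carrier_vec n"
  shows "indef_inner M y x = cnj (indef_inner M x y)"
proof -
  have "cnj (M $$ (i, j)) = M $$ (j, i)" if "i < n" "j < n" for i j
    using mat_adjoint_index[OF M(1), of j i] M(2) that by simp
  then have "cnj (indef_inner M x y) = (\<Sum>i<n. \<Sum>j<n. M $$ (j, i) * cnj (x $ j) * y $ i)"
    using assms by (simp add: indef_inner_alt[of M n])
  also have "\<dots> = indef_inner M y x"
    using assms by (subst sum.swap) (auto simp: indef_inner_alt[of M n] mult_ac intro!: sum.cong)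
  finally show ?thesis by simp
qed

lemma indef_inner_mult_mat:
  assumes "H \<in> carrier_mat n n" "A \<in> carrier_mat n n" "x \<in> carrier_vec n"
  shows "indef_inner (H * A) x y = indef_inner H (A *\<^sub>v x) y"
  using assms unfolding indef_inner_def by (simp add: assoc_mult_mat_vec[of _ n n])

text \<open>A congruence \<open>P\<^sup>* M P\<close> is the Gram matrix of the columns of \<open>P\<close>; the index order is reversed
  because the form is linear in its first argument.\<close>

lemma adjoint_congruence_index:
  assumes "M \<in> carrier_mat n n" "P \<in> carrier_mat n m" "i < m" "j < m"
  shows "(mat_adjoint P * M * P) $$ (i, j) = indef_inner M (col P j) (col P i)"
proof -
  have "mat_adjoint P * M * P = mat_adjoint P * (M * P)"
    using assms mat_adjoint_carrier[OF assms(2)] by (intro assoc_mult_mat[of _ m n _ n _ m]) auto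
  moreover have "row (mat_adjoint P) i = conjugate (col P i)"
    using assms by (auto simp: mat_adjoint_index[OF assms(2)] mat_adjoint_def mat_of_rows_def)
  moreover have "col (M * P) j = M *\<^sub>v col P j" using assms by auto
  ultimately show ?thesis using assms unfolding indef_inner_def
    by (simp add: index_mult_mat(1) carrier_matD[OF mat_adjoint_carrier[OF assms(2)]] conjugate_vec_sprod_comm[of _ n])
qed

lemma indef_inner_unit_right:
  assumes "M \<in> carrier_mat n n" "x \<in> carrier_vec n" "b < n"
  shows "indef_inner M x (unit_vec n b) = (M *\<^sub>v x) $ b"
proof -
  have "conjugate (unit_vec n b) = (unit_vec n b :: complex vec)" by (intro eq_vecI) (auto simp: unit_vec_def)
  then show ?thesis using assms unfolding indef_inner_def by (simp add: scalar_prod_right_unit)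
qed

section \<open>Positive semidefinite forms\<close>

definition pos_form :: "nat \<Rightarrow> complex mat \<Rightarrow> bool" where
  "pos_form n K \<longleftrightarrow> K \<in> carrier_mat n n \<and> (\<forall>x \<in> carrier_vec n. 0 \<le> indef_inner K x x)"

text \<open>Polarization: real values on \<open>x + y\<close> and \<open>x + \<i> y\<close> force the Hermitian symmetry.\<close>

lemma pos_form_hermitian:
  assumes K: "pos_form n K" and x: "x \<in> carrier_vec n" and y: "y \<in> carrier_vec n"
  shows "indef_inner K y x = cnj (indef_inner K x y)"
proof -
  have Kc: "K \<in> carrier_mat n n" and pos: "\<And>x. x \<in> carrier_vec n \<Longrightarrow> Im (indef_inner K x x) = 0"
    using K unfolding pos_form_def by (auto simp: less_eq_complex_def)
  have "Im (indef_inner K (x + y) (x + y)) = 0" "Im (indef_inner K (x + \<i> \<cdot>\<^sub>v y) (x + \<i> \<cdot>\<^sub>v y)) = 0"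
    using x y pos by auto
  then show ?thesis using x y Kc pos[OF x] pos[OF y]
    by (simp add: indef_inner_linear[of _ n] complex_eq_iff)
qed

text \<open>The degenerate case of the Cauchy--Schwarz inequality. If \<open>k(x, y) \<noteq> 0\<close>, then adding to \<open>y\<close> a
  large multiple of \<open>x\<close> of suitable phase changes \<open>k(y, y)\<close> linearly in the size of the
  multiple, and the value becomes negative.\<close>

lemma pos_form_null:
  assumes K: "pos_form n K" and x: "x \<in> carrier_vec n" and y: "y \<in> carrier_vec n"
    and 0: "indef_inner K x x = 0"
  shows "indef_inner K x y = 0" "indef_inner K y x = 0"
proof -
  let ?k = "indef_inner K x y" and ?b = "Re (indef_inner K y y)"
  have Kc: "K \<in> carrier_mat n n" using K unfolding pos_form_def by auto
  have yx: "indef_inner K y x = cnj ?k" by (rule pos_form_hermitian[OF K x y])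
  show "?k = 0"
  proof (rule ccontr)
    assume nz: "?k \<noteq> 0"
    have k2: "?k * cnj ?k = of_real ((cmod ?k)\<^sup>2)" by (rule complex_norm_square[symmetric])
    \<comment> \<open>this makes the value of the form at \<open>t x + y\<close> equal to -1\<close>
    define r where "r = (?b + 1) / (2 * (cmod ?k)\<^sup>2)"
    define t where "t = - of_real r * cnj ?k"
    have "0 \<le> indef_inner K (t \<cdot>\<^sub>v x + y) (t \<cdot>\<^sub>v x + y)"
      using K x y unfolding pos_form_def by auto
    moreover have "indef_inner K (t \<cdot>\<^sub>v x + y) (t \<cdot>\<^sub>v x + y)
        = t * ?k + cnj (t * ?k) + indef_inner K y y"
      using x y Kc 0 by (simp add: indef_inner_linear[of _ n] yx)
    moreover have tk: "t * ?k = - of_real (r * (cmod ?k)\<^sup>2)"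
      unfolding t_def using k2 by (simp add: algebra_simps)
    ultimately have "0 \<le> - 2 * r * (cmod ?k)\<^sup>2 + ?b"
      by (simp add: less_eq_complex_def)
    also have "- 2 * r * (cmod ?k)\<^sup>2 + ?b = -1" using nz unfolding r_def by (simp add: field_simps)
    finally show False by simp
  qed
  then show "indef_inner K y x = 0" using yx by simp
qed

section \<open>Exchanging vectors in a pseudo-orthonormal basis\<close>

text \<open>A pseudo-orthonormal basis with signs \<open>sg\<close>. That the \<open>n\<close> vectors span the
  space is a consequence of the nonzero signs, used in the form of the Parseval identity below.\<close>

definition frame :: "nat \<Rightarrow> complex mat \<Rightarrow> (nat \<Rightarrow> real) \<Rightarrow> (nat \<Rightarrow> complex vec) \<Rightarrow> bool" where
  "frame n H sg f \<longleftrightarrow> (\<forall>i<n. f i \<in> carrier_vec n) \<and>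
     (\<forall>i<n. \<forall>j<n. indef_inner H (f i) (f j) = (if i = j then of_real (sg i) else 0))"

lemma frame_carrier: "frame n H sg f \<Longrightarrow> i < n \<Longrightarrow> f i \<in> carrier_vec n"
  unfolding frame_def by auto

lemma frame_inner: "frame n H sg f \<Longrightarrow> i < n \<Longrightarrow> j < n \<Longrightarrow>
    indef_inner H (f i) (f j) = (if i = j then of_real (sg i) else 0)"
  unfolding frame_def by auto

text \<open>For the matrix \<open>F\<close> of the basis and the diagonal matrix \<open>D\<close> of its signs, \<open>F\<^sup>* H F = D\<close> and
  \<open>D\<^sup>2 = 1\<close> say that \<open>D F\<^sup>* H\<close> is a left inverse of \<open>F\<close>. It is then also a right inverse,
  which is the expansion of a vector in the basis.\<close>

lemma frame_parseval:
  assumes H: "H \<in> carrier_mat n n" "mat_adjoint H = H"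
    and sg: "\<And>i. i < n \<Longrightarrow> sg i = 1 \<or> sg i = -1"
    and f: "frame n H sg f" and u: "u \<in> carrier_vec n"
  shows "indef_inner H u u = (\<Sum>i<n. of_real (sg i * (cmod (indef_inner H u (f i)))\<^sup>2))"
proof -
  define F where "F = mat_of_cols n (map f [0..<n])"
  define D where "D = mat n n (\<lambda>(i, j). if i = j then complex_of_real (sg i) else 0)"
  have F: "F \<in> carrier_mat n n" and D: "D \<in> carrier_mat n n"
    unfolding F_def D_def by (auto simp: mat_of_cols_def)
  have Fa: "mat_adjoint F \<in> carrier_mat n n" using F by (rule mat_adjoint_carrier)
  have colF: "col F i = f i" if "i < n" for i
    unfolding F_def using that frame_carrier[OF f] by (subst col_mat_of_cols) auto
  have "mat_adjoint F * H * F = D"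
  proof (rule eq_matI)
    fix i j assume "i < dim_row D" "j < dim_col D"
    then have ij: "i < n" "j < n" using D by auto
    then show "(mat_adjoint F * H * F) $$ (i, j) = D $$ (i, j)"
      using adjoint_congruence_index[OF H(1) F ij] colF frame_inner[OF f]
      by (simp add: D_def)
  qed (use F D carrier_matD[OF Fa] in auto)
  moreover have DD: "D * D = 1\<^sub>m n"
  proof (rule eq_matI)
    fix i j assume "i < dim_row (1\<^sub>m n)" "j < dim_col (1\<^sub>m n)"
    then have ij: "i < n" "j < n" by auto
    have "(D * D) $$ (i, j) = (\<Sum>l<n. D $$ (i, l) * D $$ (l, j))"
      using ij D by (auto simp: scalar_prod_def lessThan_atLeast0)
    also have "\<dots> = (\<Sum>l<n. if l = i then (if i = j then 1 else 0) else 0)"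
      using ij sg[of i] by (intro sum.cong) (auto simp: D_def)
    finally show "(D * D) $$ (i, j) = 1\<^sub>m n $$ (i, j)" using ij by simp
  qed (use D in auto)
  moreover have FH: "mat_adjoint F * H \<in> carrier_mat n n" by (rule mult_carrier_mat[OF Fa H(1)])
  moreover have "(D * (mat_adjoint F * H)) * F = D * ((mat_adjoint F * H) * F)"
    by (rule assoc_mult_mat[OF D FH F])
  ultimately have "(D * (mat_adjoint F * H)) * F = 1\<^sub>m n" by simp
  then have inv: "F * (D * (mat_adjoint F * H)) = 1\<^sub>m n"
    by (rule mat_mult_left_right_inverse[OF mult_carrier_mat[OF D FH] F])
  define w where "w = (mat_adjoint F * H) *\<^sub>v u"
  have w: "w \<in> carrier_vec n" unfolding w_def
    by (rule mult_mat_vec_carrier[OF mult_carrier_mat[OF Fa H(1)] u])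
  have wi: "w $ i = indef_inner H u (f i)" if "i < n" for i
  proof -
    have "w = mat_adjoint F *\<^sub>v (H *\<^sub>v u)" unfolding w_def by (rule assoc_mult_mat_vec[OF Fa H(1) u])
    moreover have "row (mat_adjoint F) i = conjugate (col F i)"
      using that F by (auto simp: mat_adjoint_index[OF F] mat_adjoint_def mat_of_rows_def)
    ultimately show ?thesis using that Fa F H(1) u frame_carrier[OF f that]
      by (simp add: colF indef_inner_def conjugate_vec_sprod_comm[of _ n])
  qed
  have "u = F * (D * (mat_adjoint F * H)) *\<^sub>v u" using inv u by simp
  also have "\<dots> = F *\<^sub>v (D *\<^sub>v w)"
    unfolding w_def assoc_mult_mat_vec[OF F mult_carrier_mat[OF D FH] u]
      assoc_mult_mat_vec[OF D FH u] by (rule refl)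
  finally have u_eq: "u = F *\<^sub>v (D *\<^sub>v w)" .
  have Dw: "(D *\<^sub>v w) $ i = of_real (sg i) * w $ i" if "i < n" for i
  proof -
    have "(D *\<^sub>v w) $ i = (\<Sum>l<n. D $$ (i, l) * w $ l)"
      using that D w by (auto simp: scalar_prod_def lessThan_atLeast0)
    also have "\<dots> = (\<Sum>l<n. if l = i then of_real (sg i) * w $ i else 0)"
      using that by (intro sum.cong) (auto simp: D_def)
    finally show ?thesis using that by simp
  qed
  have "indef_inner H u u = (H *\<^sub>v u) \<bullet>c (F *\<^sub>v (D *\<^sub>v w))"
    unfolding indef_inner_def u_eq[symmetric] by simp
  also have "\<dots> = (\<Sum>i<n. (H *\<^sub>v u) $ i * cnj (\<Sum>j<n. F $$ (i, j) * (D *\<^sub>v w) $ j))"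
    using F D w H(1) u by (auto simp: scalar_prod_def lessThan_atLeast0 intro!: sum.cong)
  also have "\<dots> = (\<Sum>j<n. (\<Sum>i<n. (H *\<^sub>v u) $ i * cnj (F $$ (i, j))) * cnj ((D *\<^sub>v w) $ j))"
    by (simp add: sum_distrib_left sum_distrib_right mult_ac) (rule sum.swap)
  also have "\<dots> = (\<Sum>j<n. indef_inner H u (f j) * cnj ((D *\<^sub>v w) $ j))"
  proof (intro sum.cong refl arg_cong2[of _ _ _ _ "(*)"])
    fix j assume "j \<in> {..<n}"
    then have j: "j < n" by simp
    show "(\<Sum>i<n. (H *\<^sub>v u) $ i * cnj (F $$ (i, j))) = indef_inner H u (f j)"
      unfolding indef_inner_def colF[OF j, symmetric]
      using F j by (simp add: scalar_prod_def lessThan_atLeast0)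
  qed
  also have "\<dots> = (\<Sum>i<n. of_real (sg i * (cmod (indef_inner H u (f i)))\<^sup>2))"
  proof (intro sum.cong refl)
    fix i assume "i \<in> {..<n}"
    then have i: "i < n" by simp
    show "indef_inner H u (f i) * cnj ((D *\<^sub>v w) $ i) = of_real (sg i * (cmod (indef_inner H u (f i)))\<^sup>2)"
      using complex_norm_square[of "indef_inner H u (f i)"]
      by (simp add: Dw[OF i] wi[OF i] mult_ac)
  qed
  finally show ?thesis by simp
qed

text \<open>With \<open>d = f\<^sub>i - u\<close> and \<open>\<delta> = h(f\<^sub>i, d)\<close>, the map \<open>x \<mapsto> x - h(x, d) / \<delta> d\<close> sends \<open>f\<^sub>i\<close> to \<open>u\<close>. It
  preserves \<open>h\<close> since \<open>h(d, d) = \<delta> + cnj \<delta>\<close>, which is where the equality of \<open>h(u, u)\<close> and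
  \<open>h(f\<^sub>i, f\<^sub>i)\<close> enters, and it fixes every vector orthogonal to \<open>f\<^sub>i\<close> and \<open>u\<close>. Unlike the true
  reflection in \<open>d\<close>, it needs only \<open>\<delta> \<noteq> 0\<close>, and no adjustment of the phase of \<open>u\<close>.\<close>

lemma frame_exchange_neq:
  assumes H: "H \<in> carrier_mat n n" "mat_adjoint H = H"
    and f: "frame n H sg f" and u: "u \<in> carrier_vec n" and i: "i < n"
    and uu: "indef_inner H u u = of_real (sg i)"
    and neq: "indef_inner H (f i) u \<noteq> of_real (sg i)"
  shows "\<exists>f'. frame n H sg f' \<and> f' i = u \<and>
    (\<forall>a<n. a \<noteq> i \<longrightarrow> indef_inner H u (f a) = 0 \<longrightarrow> f' a = f a) \<and>
    (\<forall>a<n. \<exists>c c'. f' a = f a + (c \<cdot>\<^sub>v f i + c' \<cdot>\<^sub>v u))"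
proof -
  let ?h = "indef_inner H"
  have fc: "\<And>a. a < n \<Longrightarrow> f a \<in> carrier_vec n" using f by (rule frame_carrier)
  define d where "d = f i + (-1) \<cdot>\<^sub>v u"
  have d: "d \<in> carrier_vec n" unfolding d_def using fc[OF i] u by auto
  define \<delta> where "\<delta> = ?h (f i) d"
  have \<delta>: "\<delta> = of_real (sg i) - ?h (f i) u"
    unfolding \<delta>_def d_def using H(1) fc[OF i] u frame_inner[OF f i i]
    by (simp add: indef_inner_linear[of _ n])
  have \<delta>0: "\<delta> \<noteq> 0" using neq \<delta> by simp
  have dd: "?h d d = \<delta> + cnj \<delta>"
    using H(1) fc[OF i] u frame_inner[OF f i i] uu indef_inner_hermitian[OF H fc[OF i] u]
    unfolding \<delta> d_def by (simp add: indef_inner_linear[of _ n])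
  define f' where "f' = (\<lambda>a. f a + (- (?h (f a) d / \<delta>)) \<cdot>\<^sub>v d)"
  have f'c: "f' a \<in> carrier_vec n" if "a < n" for a unfolding f'_def using fc[OF that] d by auto
  have "frame n H sg f'"
    unfolding frame_def
  proof (intro conjI allI impI)
    fix a b assume a: "a < n" and b: "b < n"
    have "?h (f' a) (f' b) = ?h (f a) (f b)"
      unfolding f'_def using H(1) fc[OF a] fc[OF b] d \<delta>0 dd
        indef_inner_hermitian[OF H fc[OF b] d]
      by (simp add: indef_inner_linear[of _ n] field_simps)
    then show "?h (f' a) (f' b) = (if a = b then of_real (sg a) else 0)"
      using frame_inner[OF f a b] by simp
  qed (use f'c in auto)
  moreover have "f' i = u"
  proof -
    have "f' i = f i + (-1) \<cdot>\<^sub>v d" unfolding f'_def using \<delta>0 by (simp add: \<delta>_def[symmetric])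
    then show ?thesis unfolding d_def using fc[OF i] u by auto
  qed
  moreover have "f' a = f a" if a: "a < n" "a \<noteq> i" and ua: "?h u (f a) = 0" for a
  proof -
    have "?h (f a) u = 0" using indef_inner_hermitian[OF H u fc[OF a(1)]] ua by simp
    then have "?h (f a) d = 0"
      unfolding d_def using H(1) fc[OF i] fc[OF a(1)] u frame_inner[OF f a(1) i] a(2)
      by (simp add: indef_inner_linear[of _ n])
    then show ?thesis unfolding f'_def using fc[OF a(1)] d by auto
  qed
  moreover have "\<exists>c c'. f' a = f a + (c \<cdot>\<^sub>v f i + c' \<cdot>\<^sub>v u)" if a: "a < n" for a
  proof -
    have "f a + (- c) \<cdot>\<^sub>v d = f a + ((- c) \<cdot>\<^sub>v f i + c \<cdot>\<^sub>v u)" for c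
      unfolding d_def using fc[OF a] fc[OF i] u
      by (intro eq_vecI) (auto simp: algebra_simps)
    then show ?thesis unfolding f'_def by blast
  qed
  ultimately show ?thesis by blast
qed

text \<open>If the quasi-reflection for \<open>u\<close> is undefined, then the one for \<open>-u\<close> is defined, because
  \<open>h(f\<^sub>i, u)\<close> cannot equal \<open>sg i\<close> and \<open>-sg i\<close> at once; afterwards the sign of the new vector is
  reversed.\<close>

lemma frame_exchange_at:
  assumes H: "H \<in> carrier_mat n n" "mat_adjoint H = H"
    and f: "frame n H sg f" and u: "u \<in> carrier_vec n" and i: "i < n" and si: "sg i \<noteq> 0"
    and uu: "indef_inner H u u = of_real (sg i)"
  shows "\<exists>f'. frame n H sg f' \<and> f' i = u \<and>
    (\<forall>a<n. a \<noteq> i \<longrightarrow> indef_inner H u (f a) = 0 \<longrightarrow> f' a = f a) \<and>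
    (\<forall>a<n. \<exists>c c'. f' a = f a + (c \<cdot>\<^sub>v f i + c' \<cdot>\<^sub>v u))"
proof (cases "indef_inner H (f i) u = of_real (sg i)")
  case False
  then show ?thesis by (rule frame_exchange_neq[OF H f u i uu])
next
  case True
  let ?u = "(-1) \<cdot>\<^sub>v u" and ?h = "indef_inner H"
  have fc: "\<And>a. a < n \<Longrightarrow> f a \<in> carrier_vec n" using f by (rule frame_carrier)
  have u': "?u \<in> carrier_vec n" using u by auto
  have "?h ?u ?u = of_real (sg i)" using H(1) u uu by (simp add: indef_inner_linear[of _ n])
  moreover have "?h (f i) ?u \<noteq> of_real (sg i)"
    using H(1) u fc[OF i] True si by (simp add: indef_inner_linear[of _ n])
  ultimately obtain g where g: "frame n H sg g" "g i = ?u"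
    "\<And>a. a < n \<Longrightarrow> a \<noteq> i \<Longrightarrow> ?h ?u (f a) = 0 \<Longrightarrow> g a = f a"
    and gc: "\<And>a. a < n \<Longrightarrow> \<exists>c c'. g a = f a + (c \<cdot>\<^sub>v f i + c' \<cdot>\<^sub>v ?u)"
    using frame_exchange_neq[OF H f u' i] by blast
  define f' where "f' = g(i := u)"
  have gcar: "\<And>a. a < n \<Longrightarrow> g a \<in> carrier_vec n" using g(1) by (rule frame_carrier)
  have u_g: "u = (-1) \<cdot>\<^sub>v g i" using g(2) u by (auto simp: smult_smult_assoc)
  have orth: "?h (g a) u = 0 \<and> ?h u (g a) = 0" if "a < n" "a \<noteq> i" for a
    unfolding u_g using H(1) gcar[OF i] gcar[OF that(1)] frame_inner[OF g(1)] that i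
    by (simp add: indef_inner_linear[of _ n])
  have "frame n H sg f'"
    unfolding frame_def f'_def using gcar u uu orth frame_inner[OF g(1)] by auto
  moreover have "f' a = f a" if a: "a < n" "a \<noteq> i" and ua: "?h u (f a) = 0" for a
    using g(3)[OF a] ua H(1) u fc[OF a(1)] a(2) unfolding f'_def
    by (simp add: indef_inner_linear[of _ n])
  moreover have "\<exists>c c'. f' a = f a + (c \<cdot>\<^sub>v f i + c' \<cdot>\<^sub>v u)" if a: "a < n" for a
  proof (cases "a = i")
    case True
    have "f' a = f a + ((-1) \<cdot>\<^sub>v f i + 1 \<cdot>\<^sub>v u)"
      unfolding f'_def True using fc[OF i] u by auto
    then show ?thesis by blast
  next
    case False
    obtain c c' where "g a = f a + (c \<cdot>\<^sub>v f i + c' \<cdot>\<^sub>v ?u)" using gc[OF a] by blast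
    then have "f' a = f a + (c \<cdot>\<^sub>v f i + (-c') \<cdot>\<^sub>v u)"
      unfolding f'_def using False by (auto simp: smult_smult_assoc)
    then show ?thesis by blast
  qed
  ultimately show ?thesis using f'_def by auto
qed

text \<open>By the Parseval identity \<open>h(u, u) = e\<close> is a sum of the terms \<open>sg i |h(u, f\<^sub>i)|\<^sup>2\<close>, so at least one
  basis vector that is not orthogonal to \<open>u\<close> has the sign \<open>e\<close>. The last two conclusions keep track of
  how the other basis vectors move: those orthogonal to \<open>u\<close> stay, and each changes only by
  a combination of \<open>f\<^sub>i\<close> and \<open>u\<close>.\<close>

lemma frame_exchange:
  assumes H: "H \<in> carrier_mat n n" "mat_adjoint H = H"
    and sg: "\<And>i. i < n \<Longrightarrow> sg i = 1 \<or> sg i = -1"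
    and f: "frame n H sg f" and u: "u \<in> carrier_vec n"
    and uu: "indef_inner H u u = of_real e" and e: "e = 1 \<or> e = -1"
  shows "\<exists>i f'. i < n \<and> sg i = e \<and> indef_inner H u (f i) \<noteq> 0 \<and> frame n H sg f' \<and> f' i = u \<and>
    (\<forall>a<n. a \<noteq> i \<longrightarrow> indef_inner H u (f a) = 0 \<longrightarrow> f' a = f a) \<and>
    (\<forall>a<n. \<exists>c c'. f' a = f a + (c \<cdot>\<^sub>v f i + c' \<cdot>\<^sub>v u))"
proof -
  let ?h = "indef_inner H"
  have "\<exists>i<n. sg i = e \<and> ?h u (f i) \<noteq> 0"
  proof (rule ccontr)
    assume "\<not> ?thesis"
    then have neg: "e * (sg i * (cmod (?h u (f i)))\<^sup>2) \<le> 0" if "i < n" for i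
      using that sg[OF that] e by auto
    have "complex_of_real e = of_real (\<Sum>i<n. sg i * (cmod (?h u (f i)))\<^sup>2)"
      using frame_parseval[OF H sg f u] uu by simp
    then have "e = (\<Sum>i<n. sg i * (cmod (?h u (f i)))\<^sup>2)" by (simp only: of_real_eq_iff)
    then have "e * e = (\<Sum>i<n. e * (sg i * (cmod (?h u (f i)))\<^sup>2))" by (metis sum_distrib_left)
    also have "\<dots> \<le> 0" using neg by (intro sum_nonpos) auto
    finally show False using e by auto
  qed
  then obtain i where i: "i < n" "sg i = e" "?h u (f i) \<noteq> 0" by blast
  have "sg i \<noteq> 0" "?h u u = of_real (sg i)" using i e uu by auto
  from frame_exchange_at[OF H f u i(1) this] i show ?thesis by blast
qed

section \<open>Splitting off hyperbolic planes\<close>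

text \<open>From \<open>k(f\<^sub>l, f\<^sub>l) \<noteq> 0\<close> a chain \<open>e\<^sub>1, e\<^sub>2\<close> is built, and then its orthonormal basis
  \<open>u, v = (e\<^sub>2 \<plusminus> e\<^sub>1) / sqrt 2\<close> is exchanged into the basis, \<open>u\<close> at a positive index and \<open>v\<close> at a negative
  one. All of this happens inside the part with indices in \<open>I\<close>: as \<open>f\<^sub>l\<close>, and hence \<open>A f\<^sub>l\<close>, is
  orthogonal to the vectors outside, these do not move and stay \<open>k\<close>-orthogonal to the part
  inside. The values 1/2 are \<open>k(e\<^sub>2, e\<^sub>2) / 2\<close>, since \<open>k\<close> vanishes on \<open>e\<^sub>1\<close>.\<close>

lemma frame_hyperbolic_step:
  assumes H: "H \<in> carrier_mat n n" "mat_adjoint H = H" and A: "A \<in> carrier_mat n n"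
    and pos: "pos_form n (H * A)"
    and sg: "\<And>i. i < n \<Longrightarrow> sg i = 1 \<or> sg i = -1"
    and f: "frame n H sg f" and I: "I \<subseteq> {..<n}" and l: "l \<in> I"
    and dec: "\<And>a b. a \<in> I \<Longrightarrow> b \<in> {..<n} - I \<Longrightarrow> indef_inner (H * A) (f a) (f b) = 0"
    and kl: "indef_inner (H * A) (f l) (f l) \<noteq> 0"
    and AA: "A *\<^sub>v (A *\<^sub>v f l) = 0\<^sub>v n"
  shows "\<exists>f' i j. frame n H sg f' \<and> i \<in> I \<and> j \<in> I \<and> sg i = 1 \<and> sg j = -1 \<and>
    (\<forall>b \<in> {..<n} - I. f' b = f b) \<and>
    (\<forall>a \<in> {i, j}. \<forall>b \<in> {i, j}. indef_inner (H * A) (f' a) (f' b) = 1/2) \<and>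
    (\<forall>a \<in> {i, j}. \<forall>b \<in> {..<n} - {i, j}. indef_inner (H * A) (f' a) (f' b) = 0) \<and>
    (\<forall>a \<in> I. \<forall>b \<in> {..<n} - I. indef_inner (H * A) (f' a) (f' b) = 0)"
proof -
  let ?h = "indef_inner H" and ?k = "indef_inner (H * A)"
  have K: "H * A \<in> carrier_mat n n" using H(1) A by auto
  have fc: "\<And>a. a < n \<Longrightarrow> f a \<in> carrier_vec n" using f by (rule frame_carrier)
  have ln: "l < n" using l I by auto
  have fl: "f l \<in> carrier_vec n" by (rule fc[OF ln])
  have pk: "0 \<le> ?k (f l) (f l)" using pos fl unfolding pos_form_def by auto
  define r where "r = Re (?k (f l) (f l))"
  have kr: "?k (f l) (f l) = of_real r" and r: "r > 0"
    using pk kl unfolding r_def by (auto simp: less_eq_complex_def complex_eq_iff)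
  define t where "t = complex_of_real (1 / sqrt r)"
  have t: "cnj t = t" "t * (t * of_real r) = 1"
    unfolding t_def using r by (simp_all add: field_simps flip: of_real_mult)
  define x where "x = t \<cdot>\<^sub>v f l"
  have x: "x \<in> carrier_vec n" unfolding x_def using fl by auto
  have kx: "?k x x = 1"
    unfolding x_def using K fl kr t by (simp add: indef_inner_linear[of _ n])
  define e1 where "e1 = A *\<^sub>v x"
  have e1: "e1 \<in> carrier_vec n" unfolding e1_def using A x by auto
  have Ae1: "A *\<^sub>v e1 = 0\<^sub>v n"
    unfolding e1_def x_def using A fl AA by (auto simp: mult_mat_vec[of _ n n])
  have k_h: "?k y z = ?h (A *\<^sub>v y) z" if "y \<in> carrier_vec n" for y z
    by (rule indef_inner_mult_mat[OF H(1) A that])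
  have h0: "?h (0\<^sub>v n) z = 0" if "z \<in> carrier_vec n" for z
  proof -
    have "H *\<^sub>v 0\<^sub>v n = 0\<^sub>v n" using H(1) by (intro eq_vecI) auto
    then show ?thesis using that unfolding indef_inner_def by simp
  qed
  have ke1: "?k e1 z = 0" if "z \<in> carrier_vec n" for z
    using k_h[OF e1] Ae1 h0[OF that] by simp
  have ke1': "?k z e1 = 0" if "z \<in> carrier_vec n" for z
    using pos_form_hermitian[OF pos e1 that] ke1[OF that] by simp
  have he1: "?h e1 z = ?k x z" if "z \<in> carrier_vec n" for z
    using k_h[OF x] by (simp add: e1_def)
  have e1e1: "?h e1 e1 = 0" using he1[OF e1] ke1'[OF x] by simp
  have e1x: "?h e1 x = 1" using he1[OF x] kx by simp
  have xe1: "?h x e1 = 1" using indef_inner_hermitian[OF H e1 x] e1x by simp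
  have hxx: "cnj (?h x x) = ?h x x" using indef_inner_hermitian[OF H x x] by simp
  \<comment> \<open>the coefficient makes \<open>e2\<close> isotropic: \<open>h(x, x)\<close> is real and \<open>h(e1, x) = 1\<close>\<close>
  define e2 where "e2 = x + (- (?h x x / 2)) \<cdot>\<^sub>v e1"
  have e2: "e2 \<in> carrier_vec n" unfolding e2_def using x e1 by auto
  have e12: "?h e1 e2 = 1" "?h e2 e1 = 1" and e22: "?h e2 e2 = 0"
    unfolding e2_def using H(1) x e1 e1e1 e1x xe1 hxx by (simp_all add: indef_inner_linear[of _ n])
  have ke2: "?k e2 z = ?k x z" if "z \<in> carrier_vec n" for z
    unfolding e2_def using K x e1 that ke1[OF that] by (simp add: indef_inner_linear[of _ n])
  have ke2': "?k e2 e2 = 1"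
    using ke2[OF e2] K x e1 ke1'[OF x] kx by (simp add: e2_def indef_inner_linear[of _ n])
  define s where "s = complex_of_real (1 / sqrt 2)"
  have ss: "s * s = 1/2" "cnj s = s"
    unfolding s_def by (simp_all flip: of_real_mult)
  define u where "u = s \<cdot>\<^sub>v (e2 + e1)"
  define v where "v = s \<cdot>\<^sub>v (e2 + (-1) \<cdot>\<^sub>v e1)"
  have u: "u \<in> carrier_vec n" and v: "v \<in> carrier_vec n"
    unfolding u_def v_def using e1 e2 by auto
  have s_mult: "s * (s * t) = t / 2" for t using ss(1) by (simp flip: mult.assoc)
  have s2: "s * (2 * s) = 1" using ss(1) by (simp add: mult_ac)
  have huu: "?h u u = of_real 1" and hvv: "?h v v = of_real (-1)" and hvu: "?h v u = 0"
    unfolding u_def v_def using H(1) e1 e2 e1e1 e12 e22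
    by (simp_all add: indef_inner_linear[of _ n] ss s_mult s2)
  have ku: "?k u z = s * ?k x z" and kv: "?k v z = s * ?k x z" if "z \<in> carrier_vec n" for z
    unfolding u_def v_def using K e1 e2 that ke1[OF that] ke2[OF that]
    by (simp_all add: indef_inner_linear[of _ n])
  have kxu: "?k x u = s" and kxv: "?k x v = s"
    unfolding u_def v_def using K x e1 e2 ke1'[OF x] ke2[OF e2] ke2'
    by (simp_all add: indef_inner_linear[of _ n] ss)
  have kuv: "?k y z = 1/2" if "y \<in> {u, v}" "z \<in> {u, v}" for y z
    using that ku[OF u] ku[OF v] kv[OF u] kv[OF v] kxu kxv ss by auto
  have kxb: "?k x (f b) = 0" if "b \<in> {..<n} - I" for b
    unfolding x_def using K fl fc[of b] that dec[OF l that] by (simp add: indef_inner_linear[of _ n])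
  have hub: "?h y (f b) = 0" if "b \<in> {..<n} - I" "y \<in> {u, v}" for b y
  proof -
    have b: "b < n" "b \<noteq> l" using that l by auto
    have "?h x (f b) = 0"
      unfolding x_def using H(1) fl fc[OF b(1)] frame_inner[OF f ln b(1)] b(2)
      by (simp add: indef_inner_linear[of _ n])
    moreover have "?h e1 (f b) = 0" using he1[OF fc[OF b(1)]] kxb[OF that(1)] by simp
    ultimately have "?h e1 (f b) = 0" "?h e2 (f b) = 0"
      unfolding e2_def using H(1) x e1 fc[OF b(1)] by (simp_all add: indef_inner_linear[of _ n])
    then show ?thesis
      using that(2) H(1) e1 e2 fc[OF b(1)] unfolding u_def v_def
      by (auto simp: indef_inner_linear[of _ n])
  qed
  obtain i g where i: "i < n" "sg i = 1" "?h u (f i) \<noteq> 0" and g: "frame n H sg g" "g i = u"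
    and g_eq: "\<And>a. a < n \<Longrightarrow> a \<noteq> i \<Longrightarrow> ?h u (f a) = 0 \<Longrightarrow> g a = f a"
    and g_comb: "\<And>a. a < n \<Longrightarrow> \<exists>c c'. g a = f a + (c \<cdot>\<^sub>v f i + c' \<cdot>\<^sub>v u)"
    using frame_exchange[OF H sg f u huu] by blast
  obtain j f' where j: "j < n" "sg j = -1" "?h v (g j) \<noteq> 0" and f': "frame n H sg f'" "f' j = v"
    and f'_eq: "\<And>a. a < n \<Longrightarrow> a \<noteq> j \<Longrightarrow> ?h v (g a) = 0 \<Longrightarrow> f' a = g a"
    and f'_comb: "\<And>a. a < n \<Longrightarrow> \<exists>c c'. f' a = g a + (c \<cdot>\<^sub>v g j + c' \<cdot>\<^sub>v v)"
    using frame_exchange[OF H sg g(1) v hvv] by blast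
  have ij: "i \<noteq> j" using i(2) j(2) by auto
  have gc: "\<And>a. a < n \<Longrightarrow> g a \<in> carrier_vec n" using g(1) by (rule frame_carrier)
  have f'c: "\<And>a. a < n \<Longrightarrow> f' a \<in> carrier_vec n" using f'(1) by (rule frame_carrier)
  have iI: "i \<in> I" using i(1,3) hub[of i u] by auto
  have gb: "g b = f b" if "b \<in> {..<n} - I" for b using that iI hub[OF that, of u] g_eq[of b] by auto
  have jI: "j \<in> I" 
  proof (rule ccontr)
    assume "j \<notin> I"
    then have "j \<in> {..<n} - I" using j(1) by simp
    from hub[OF this, of v] gb[OF this] j(3) show False by simp
  qed
  have f'b: "f' b = f b" if "b \<in> {..<n} - I" for b
    using that jI hub[OF that, of v] gb[OF that] f'_eq[of b] by auto
  have f'i: "f' i = u" using f'_eq[OF i(1) ij] g(2) hvu by simp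
  have k_eq: "?k (f' a) z = s * ?k x z" if "a \<in> {i, j}" "z \<in> carrier_vec n" for a z
    using that f'i f'(2) ku kv by auto
  \<comment> \<open>a vector orthogonal to \<open>u\<close> and \<open>v\<close> is orthogonal to \<open>e1 = A x\<close>, hence \<open>k\<close>-orthogonal to \<open>x\<close>\<close>
  have e1_uv: "?h e1 z = s * (?h u z - ?h v z)" if "z \<in> carrier_vec n" for z
    unfolding u_def v_def using H(1) e1 e2 that
    by (simp add: indef_inner_linear[of _ n] algebra_simps s_mult)
  have rest: "?k (f' a) (f' b) = 0" if "a \<in> {i, j}" "b \<in> {..<n} - {i, j}" for a b
  proof -
    have b: "b < n" "b \<noteq> i" "b \<noteq> j" using that by auto
    have "?h u (f' b) = 0" "?h v (f' b) = 0"
      using frame_inner[OF f'(1) i(1) b(1)] frame_inner[OF f'(1) j(1) b(1)] b f'i f'(2) by auto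
    then have "?k x (f' b) = 0" using he1[OF f'c[OF b(1)]] e1_uv[OF f'c[OF b(1)]] by simp
    then show ?thesis using k_eq[OF that(1) f'c[OF b(1)]] by simp
  qed
  have dec': "?k (f' a) (f' b) = 0" if a: "a \<in> I" and b: "b \<in> {..<n} - I" for a b
  proof -
    have an: "a < n" and bn: "b < n" using a b I by auto
    have fb: "f b \<in> carrier_vec n" by (rule fc[OF bn])
    have ub: "?k u (f b) = 0" "?k v (f b) = 0" using ku[OF fb] kv[OF fb] kxb[OF b] by auto
    have gz: "?k (g c) (f b) = 0" if "c \<in> I" for c
    proof -
      have cn: "c < n" using that I by auto
      obtain p q where "g c = f c + (p \<cdot>\<^sub>v f i + q \<cdot>\<^sub>v u)" using g_comb[OF cn] by blast
      then show ?thesis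
        using K fc[OF cn] fc[OF i(1)] u fb ub dec[OF that b] dec[OF iI b]
        by (simp add: indef_inner_linear[of _ n])
    qed
    obtain p q where "f' a = g a + (p \<cdot>\<^sub>v g j + q \<cdot>\<^sub>v v)" using f'_comb[OF an] by blast
    then have "?k (f' a) (f b) = 0"
      using K gc[OF an] gc[OF j(1)] v fb ub gz[OF a] gz[OF jI]
      by (simp add: indef_inner_linear[of _ n])
    then show ?thesis using f'b[OF b] by simp
  qed
  have "\<forall>a \<in> {i, j}. \<forall>b \<in> {i, j}. ?k (f' a) (f' b) = 1/2"
    using kuv f'i f'(2) by auto
  then show ?thesis
    using f'(1) iI jI i(2) j(2) f'b rest dec' by blast
qed

text \<open>The preceding step is repeated on \<open>I\<close> without \<open>i\<close> and \<open>j\<close> until \<open>k\<close> vanishes on all remaining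
  diagonal entries, and therefore on the whole remaining part. The family \<open>d\<close> describes the
  vectors whose orthogonal complement is annihilated by \<open>A\<^sup>2\<close>. They belong to the basis outside \<open>I\<close>,
  so they are never exchanged and \<open>A\<^sup>2\<close> vanishes on every basis vector met on the way.\<close>

lemma hyperbolic_frame_exists:
  assumes H: "H \<in> carrier_mat n n" "mat_adjoint H = H" and A: "A \<in> carrier_mat n n"
    and pos: "pos_form n (H * A)"
    and sg: "\<And>i. i < n \<Longrightarrow> sg i = 1 \<or> sg i = -1"
    and "I \<subseteq> {..<n}" and "frame n H sg f"
    and "\<And>a b. a \<in> I \<Longrightarrow> b \<in> {..<n} - I \<Longrightarrow> indef_inner (H * A) (f a) (f b) = 0"
    and AA: "\<And>x. x \<in> carrier_vec n \<Longrightarrow> (\<And>b. b \<in> D \<Longrightarrow> indef_inner H x (d b) = 0) \<Longrightarrow>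
        A *\<^sub>v (A *\<^sub>v x) = 0\<^sub>v n"
    and "D \<subseteq> {..<n} - I" and "\<And>b. b \<in> D \<Longrightarrow> f b = d b"
  shows "\<exists>g ps xs. frame n H sg g \<and> (\<forall>b \<in> {..<n} - I. g b = f b) \<and>
    distinct (xs @ map fst ps @ map snd ps) \<and> set (xs @ map fst ps @ map snd ps) = I \<and>
    (\<forall>(i, j) \<in> set ps. sg i = 1 \<and> sg j = -1 \<and>
       (\<forall>a \<in> {i, j}. \<forall>b \<in> {i, j}. indef_inner (H * A) (g a) (g b) = 1/2) \<and>
       (\<forall>a \<in> {i, j}. \<forall>b \<in> {..<n} - {i, j}. indef_inner (H * A) (g a) (g b) = 0)) \<and>
    (\<forall>a \<in> set xs. \<forall>b<n. indef_inner (H * A) (g a) (g b) = 0)"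
  using assms(6-8,10-11)
proof (induction "card I" arbitrary: I f rule: less_induct)
  case less
  note I = less.prems(1) and f = less.prems(2) and dec = less.prems(3)
    and D = less.prems(4) and fd = less.prems(5)
  let ?k = "indef_inner (H * A)"
  have fin: "finite I" using I finite_subset by blast
  have fc: "\<And>a. a < n \<Longrightarrow> f a \<in> carrier_vec n" using f by (rule frame_carrier)
  show ?case
  proof (cases "\<forall>l\<in>I. ?k (f l) (f l) = 0")
    case True
    obtain xs where xs: "set xs = I" "distinct xs" using finite_distinct_list[OF fin] by blast
    have "?k (f a) (f b) = 0" if "a \<in> I" "b < n" for a b
      using pos_form_null(1)[OF pos fc fc[OF that(2)]] that(1) True I by auto
    then show ?thesis
      using f xs by (intro exI[of _ f] exI[of _ "[]"] exI[of _ xs]) auto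
  next
    case False
    then obtain l where l: "l \<in> I" "?k (f l) (f l) \<noteq> 0" by blast
    have ln: "l < n" using l I by auto
    have "A *\<^sub>v (A *\<^sub>v f l) = 0\<^sub>v n"
    proof (rule AA[OF fc[OF ln]])
      fix b assume b: "b \<in> D"
      then have "b < n" "l \<noteq> b" using D l by auto
      then show "indef_inner H (f l) (d b) = 0"
        using frame_inner[OF f ln, of b] fd[OF b] by simp
    qed
    from frame_hyperbolic_step[OF H A pos sg f I l(1) dec l(2) this]
    obtain f' i j where f': "frame n H sg f'" and ij: "i \<in> I" "j \<in> I" "sg i = 1" "sg j = -1"
      and f'b: "\<forall>b \<in> {..<n} - I. f' b = f b"
      and kij: "\<forall>a \<in> {i, j}. \<forall>b \<in> {i, j}. ?k (f' a) (f' b) = 1/2"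
      and kr: "\<forall>a \<in> {i, j}. \<forall>b \<in> {..<n} - {i, j}. ?k (f' a) (f' b) = 0"
      and kd: "\<forall>a \<in> I. \<forall>b \<in> {..<n} - I. ?k (f' a) (f' b) = 0"
      by blast
    let ?J = "I - {i, j}"
    have ne: "i \<noteq> j" using ij by auto
    have "card ?J < card I" using fin ij by (intro psubset_card_mono) auto
    moreover have "?J \<subseteq> {..<n}" using I by auto
    moreover note f'
    moreover have "?k (f' a) (f' b) = 0" if "a \<in> ?J" "b \<in> {..<n} - ?J" for a b
    proof (cases "b \<in> {i, j}")
      case True
      have an: "a < n" "b < n" using that I by auto
      have "?k (f' b) (f' a) = 0" using kr True that an by blast
      then show ?thesis
        using pos_form_hermitian[OF pos frame_carrier[OF f' an(2)] frame_carrier[OF f' an(1)]] by simp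
    next
      case False
      then show ?thesis using kd that by blast
    qed
    moreover have "D \<subseteq> {..<n} - ?J" using D by auto
    moreover have "f' b = d b" if "b \<in> D" for b using f'b fd[OF that] that D by auto
    ultimately obtain g ps xs where g: "frame n H sg g" "\<forall>b \<in> {..<n} - ?J. g b = f' b"
      and dist: "distinct (xs @ map fst ps @ map snd ps)" "set (xs @ map fst ps @ map snd ps) = ?J"
      and ps: "\<forall>(i, j) \<in> set ps. sg i = 1 \<and> sg j = -1 \<and>
       (\<forall>a \<in> {i, j}. \<forall>b \<in> {i, j}. ?k (g a) (g b) = 1/2) \<and>
       (\<forall>a \<in> {i, j}. \<forall>b \<in> {..<n} - {i, j}. ?k (g a) (g b) = 0)"
      and xs: "\<forall>a \<in> set xs. \<forall>b<n. ?k (g a) (g b) = 0"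
      using less.hyps[of ?J f'] by blast
    have gij: "g i = f' i" "g j = f' j" using g(2) ij I by auto
    have pij: "\<forall>a \<in> {i, j}. \<forall>b \<in> {i, j}. ?k (g a) (g b) = 1/2"
      using kij gij by auto
    have jn: "i < n" "j < n" using ij I by auto
    have ps_J: "p \<in> ?J" "p' \<in> ?J" if "(p, p') \<in> set ps" for p p'
    proof -
      have "p \<in> set (map fst ps)" "p' \<in> set (map snd ps)" using that by (auto intro: rev_image_eqI)
      then show "p \<in> ?J" "p' \<in> ?J" unfolding dist(2)[symmetric] by simp_all
    qed
    have pair_k: "?k (g p) (g a) = 0 \<and> ?k (g p') (g a) = 0"
      if "(p, p') \<in> set ps" "a \<in> {..<n} - {p, p'}" for p p' a
    proof -
      from bspec[OF ps that(1)] have "\<forall>a \<in> {p, p'}. \<forall>b \<in> {..<n} - {p, p'}. ?k (g a) (g b) = 0"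
        by simp
      then show ?thesis using that(2) by blast
    qed
    have he1: "?k (g a) (g b) = 0" if a: "a \<in> {i, j}" and b: "b \<in> {..<n} - {i, j}" for a b
    proof (cases "b \<in> I")
      case False
      then show ?thesis using g(2) gij kr a b by auto
    next
      case True
      then have "b \<in> set xs \<or> b \<in> fst ` set ps \<or> b \<in> snd ` set ps" using dist(2) b by auto
      moreover have an: "a < n" "b < n" using a b jn by auto
      moreover have "a \<notin> ?J" using a by auto
      ultimately have "?k (g b) (g a) = 0"
      proof (elim disjE)
        assume "b \<in> set xs"
        then show ?thesis using xs an by auto
      next
        assume "b \<in> fst ` set ps"
        then obtain p where p: "(b, p) \<in> set ps" by auto
        have "a \<in> {..<n} - {b, p}" using ps_J[OF p] an a by auto
        then show ?thesis using pair_k[OF p] by blast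
      next
        assume "b \<in> snd ` set ps"
        then obtain p where p: "(p, b) \<in> set ps" by auto
        have "a \<in> {..<n} - {p, b}" using ps_J[OF p] an a by auto
        then show ?thesis using pair_k[OF p] by blast
      qed
      then show ?thesis
        using pos_form_hermitian[OF pos frame_carrier[OF g(1) an(2)] frame_carrier[OF g(1) an(1)]]
        by simp
    qed
    have "distinct (xs @ map fst ((i, j) # ps) @ map snd ((i, j) # ps))"
      using dist ne by auto
    moreover have "set (xs @ map fst ((i, j) # ps) @ map snd ((i, j) # ps)) = I"
      using dist(2) ij by auto
    moreover have "\<forall>b \<in> {..<n} - I. g b = f b" using g(2) f'b by auto
    ultimately show ?thesis
      using g(1) ps xs pij he1 ij(3,4)
      by (intro exI[of _ g] exI[of _ "(i, j) # ps"] exI[of _ xs]) auto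
  qed
qed

section \<open>Block diagonal Gram matrices\<close>

definition gram :: "complex mat \<Rightarrow> complex vec list \<Rightarrow> complex mat" where
  "gram M vs = mat (length vs) (length vs) (\<lambda>(i, j). indef_inner M (vs ! j) (vs ! i))"

lemma gram_dim[simp]: "dim_row (gram M vs) = length vs" "dim_col (gram M vs) = length vs"
  unfolding gram_def by auto

definition orthogonal_lists :: "complex mat \<Rightarrow> complex vec list \<Rightarrow> complex vec list \<Rightarrow> bool" where
  "orthogonal_lists M vs ws \<longleftrightarrow>
     (\<forall>x \<in> set vs. \<forall>y \<in> set ws. indef_inner M x y = 0 \<and> indef_inner M y x = 0)"

lemma gram_concat:
  assumes "sorted_wrt (orthogonal_lists M) vss"
  shows "gram M (concat vss) = diag_block_mat (map (gram M) vss)"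
  using assms
proof (induction vss)
  case Nil
  then show ?case by (auto simp: gram_def)
next
  case (Cons vs vss)
  then have IH: "diag_block_mat (map (gram M) vss) = gram M (concat vss)" by simp
  have orth: "indef_inner M x y = 0 \<and> indef_inner M y x = 0"
    if "x \<in> set vs" "y \<in> set (concat vss)" for x y
    using Cons.prems that unfolding orthogonal_lists_def by auto
  have "gram M (vs @ concat vss) = four_block_mat (gram M vs)
     (0\<^sub>m (length vs) (length (concat vss))) (0\<^sub>m (length (concat vss)) (length vs))
     (gram M (concat vss))" (is "?L = ?R")
  proof (rule eq_matI)
    fix i j assume "i < dim_row ?R" "j < dim_col ?R"
    then have "i < length vs + length (concat vss)" "j < length vs + length (concat vss)" by auto
    then show "?L $$ (i, j) = ?R $$ (i, j)"
      using orth[of "vs ! i" "concat vss ! (j - length vs)"]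
        orth[of "vs ! j" "concat vss ! (i - length vs)"]
      by (auto simp: gram_def nth_append simp del: length_concat set_concat)
  qed auto
  then show ?case by (simp add: IH Let_def del: length_concat)
qed

lemma gram_congruence:
  assumes M: "M \<in> carrier_mat n n" and vs: "length vs = n" "set vs \<subseteq> carrier_vec n"
  shows "mat_adjoint (mat_of_cols n vs) * M * mat_of_cols n vs = gram M vs"
proof (rule eq_matI)
  have P: "mat_of_cols n vs \<in> carrier_mat n n" using vs by auto
  show "dim_row (mat_adjoint (mat_of_cols n vs) * M * mat_of_cols n vs) = dim_row (gram M vs)"
    "dim_col (mat_adjoint (mat_of_cols n vs) * M * mat_of_cols n vs) = dim_col (gram M vs)"
    using vs carrier_matD[OF mat_adjoint_carrier[OF P]] by auto
  fix i j assume "i < dim_row (gram M vs)" "j < dim_col (gram M vs)"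
  then have ij: "i < n" "j < n" using vs by auto
  have "vs ! i \<in> carrier_vec n" "vs ! j \<in> carrier_vec n" using vs ij by auto
  then show "(mat_adjoint (mat_of_cols n vs) * M * mat_of_cols n vs) $$ (i, j) = gram M vs $$ (i, j)"
    using adjoint_congruence_index[OF M P ij] vs ij by (simp add: gram_def)
qed

lemma diag_block_mat_mult:
  assumes "\<And>x. x \<in> set xs \<Longrightarrow> F x \<in> carrier_mat (d x) (d x) \<and> G x \<in> carrier_mat (d x) (d x)"
  shows "diag_block_mat (map F xs) * diag_block_mat (map G xs)
     = diag_block_mat (map (\<lambda>x. F x * G x) xs)"
  using assms
proof (induction xs)
  case Nil
  then show ?case by simp
next
  case (Cons x xs)
  define m where "m = sum_list (map d xs)"
  have F: "F x \<in> carrier_mat (d x) (d x)" and G: "G x \<in> carrier_mat (d x) (d x)"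
    using Cons.prems by auto
  have dim_F: "dim_row (F y) = d y" "dim_col (F y) = d y"
    and dim_G: "dim_row (G y) = d y" "dim_col (G y) = d y" if "y \<in> set xs" for y
    using Cons.prems[of y] that by auto
  have dims: "map (dim_row \<circ> F) xs = map d xs" "map (dim_col \<circ> F) xs = map d xs"
      "map (dim_row \<circ> G) xs = map d xs" "map (dim_col \<circ> G) xs = map d xs"
      "map (dim_row \<circ> (\<lambda>x. F x * G x)) xs = map d xs" "map (dim_col \<circ> (\<lambda>x. F x * G x)) xs = map d xs"
    using dim_F dim_G by simp_all
  have Fs: "diag_block_mat (map F xs) \<in> carrier_mat m m"
    and Gs: "diag_block_mat (map G xs) \<in> carrier_mat m m"
    by (rule carrier_matI; simp only: dim_diag_block_mat map_map dims m_def)+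
  have FGs: "diag_block_mat (map (\<lambda>x. F x * G x) xs) \<in> carrier_mat m m"
    by (rule carrier_matI; simp only: dim_diag_block_mat map_map dims m_def)
  have IH: "diag_block_mat (map F xs) * diag_block_mat (map G xs)
     = diag_block_mat (map (\<lambda>x. F x * G x) xs)"
    using Cons by simp
  have FG: "F x * G x \<in> carrier_mat (d x) (d x)" using F G by auto
  have "four_block_mat (F x) (0\<^sub>m (d x) m) (0\<^sub>m m (d x)) (diag_block_mat (map F xs))
     * four_block_mat (G x) (0\<^sub>m (d x) m) (0\<^sub>m m (d x)) (diag_block_mat (map G xs))
     = four_block_mat (F x * G x) (0\<^sub>m (d x) m) (0\<^sub>m m (d x)) (diag_block_mat (map (\<lambda>x. F x * G x) xs))"
    using F G Fs Gs FG FGs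
    by (subst mult_four_block_mat[of _ "d x" "d x" _ m _ m _ _ "d x" _ m]) (auto simp: IH)
  then show ?case using carrier_matD[OF F] carrier_matD[OF G] carrier_matD[OF Fs] carrier_matD[OF Gs]
      carrier_matD[OF FG] carrier_matD[OF FGs]
    by (simp add: Let_def del: index_mult_mat)
qed

lemma diag_block_mat_diagonal:
  "diag_block_mat (map (\<lambda>i. mat 1 1 (\<lambda>_. d i)) xs)
    = mat (length xs) (length xs) (\<lambda>(i, j). if i = j then d (xs ! i) else 0)"
proof (induction xs)
  case Nil
  then show ?case by auto
next
  case (Cons x xs)
  then show ?case
    by (intro eq_matI) (auto simp: Let_def nth_Cons split: nat.splits)
qed

lemma Q_mat_carrier[simp]: "Q_mat k \<in> carrier_mat k k"
  unfolding Q_mat_def by auto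

lemma Q_mat_involution: "Q_mat k * Q_mat k = 1\<^sub>m k"
proof (rule eq_matI)
  fix i j assume "i < dim_row (1\<^sub>m k)" "j < dim_col (1\<^sub>m k)"
  then have ij: "i < k" "j < k" by auto
  have "(Q_mat k * Q_mat k) $$ (i, j) = (\<Sum>l<k. Q_mat k $$ (i, l) * Q_mat k $$ (l, j))"
    using ij by (auto simp: scalar_prod_def lessThan_atLeast0 Q_mat_def)
  also have "\<dots> = (\<Sum>l<k. if l = k - 1 - i then (if i = j then 1 else 0) else 0)"
    using ij by (intro sum.cong) (auto simp: Q_mat_def)
  finally show "(Q_mat k * Q_mat k) $$ (i, j) = 1\<^sub>m k $$ (i, j)" using ij by auto
qed (auto simp: Q_mat_def)

lemma sign_matrix_carrier:
  "sign_matrix bs \<in> carrier_mat (sum_list (map fst bs)) (sum_list (map fst bs))"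
proof -
  have "map (dim_row \<circ> (\<lambda>(k, \<theta>). complex_of_real \<theta> \<cdot>\<^sub>m Q_mat k)) bs = map fst bs"
    "map (dim_col \<circ> (\<lambda>(k, \<theta>). complex_of_real \<theta> \<cdot>\<^sub>m Q_mat k)) bs = map fst bs"
    by (auto simp: Q_mat_def)
  then show ?thesis
    unfolding sign_matrix_def by (intro carrier_matI) (simp_all only: dim_diag_block_mat map_map)
qed

lemma sign_matrix_involution:
  assumes "\<And>k \<theta>. (k, \<theta>) \<in> set bs \<Longrightarrow> \<theta> = 1 \<or> \<theta> = -1"
  shows "sign_matrix bs * sign_matrix bs = 1\<^sub>m (sum_list (map fst bs))"
proof -
  define F where "F = (\<lambda>(k :: nat, \<theta>). complex_of_real \<theta> \<cdot>\<^sub>m Q_mat k)"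
  have F: "F x \<in> carrier_mat (fst x) (fst x)" for x unfolding F_def by (cases x) simp
  have FF: "F x * F x = 1\<^sub>m (fst x)" if "x \<in> set bs" for x
  proof -
    obtain k \<theta> where x: "x = (k, \<theta>)" by (cases x)
    then have \<theta>: "\<theta> = 1 \<or> \<theta> = -1" using assms[of k \<theta>] that by simp
    have "F x * F x = complex_of_real \<theta> \<cdot>\<^sub>m (Q_mat k * (complex_of_real \<theta> \<cdot>\<^sub>m Q_mat k))"
      unfolding x F_def by (simp add: mult_smult_assoc_mat[of _ k k _ k])
    also have "Q_mat k * (complex_of_real \<theta> \<cdot>\<^sub>m Q_mat k) = complex_of_real \<theta> \<cdot>\<^sub>m 1\<^sub>m k"
      by (simp add: mult_smult_distrib[of _ k k _ k] Q_mat_involution)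
    also have "complex_of_real \<theta> \<cdot>\<^sub>m (complex_of_real \<theta> \<cdot>\<^sub>m 1\<^sub>m k) = 1\<^sub>m k"
      using \<theta> by (intro eq_matI) auto
    finally show ?thesis using x by simp
  qed
  have "sign_matrix bs * sign_matrix bs = diag_block_mat (map (\<lambda>x. F x * F x) bs)"
    unfolding sign_matrix_def F_def[symmetric] by (rule diag_block_mat_mult[where d = fst]) (simp add: F)
  also have "map (\<lambda>x. F x * F x) bs = map (\<lambda>A. 1\<^sub>m (dim_row A)) (map (\<lambda>x. 1\<^sub>m (fst x) :: complex mat) bs)"
    using FF by simp
  also have "diag_block_mat \<dots> = 1\<^sub>m (sum_list (map fst bs))"
    unfolding diag_block_one_mat by (simp add: o_def)
  finally show ?thesis .
qed

text \<open>Chains of the right Gram matrices that are orthogonal for both forms give the canonical form of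
  the pair. The inverse of \<open>P\<close> need not be computed: \<open>S P\<^sup>* H\<close> is one, by \<open>P\<^sup>* H P = S\<close> and \<open>S\<^sup>2 = 1\<close>, and
  multiplying \<open>P\<^sup>* (H A) P = S J\<close> by \<open>S\<close> turns this congruence into the similarity.\<close>

lemma canonical_form_of_chains:
  fixes T :: "(complex vec list \<times> nat \<times> real \<times> complex) list"
  defines "kth \<equiv> map (\<lambda>(vs, k, \<theta>, \<mu>). (k, \<theta>)) T" and "jbs \<equiv> map (\<lambda>(vs, k, \<theta>, \<mu>). (k, \<mu>)) T"
  assumes H: "H \<in> carrier_mat n n" and A: "A \<in> carrier_mat n n"
    and blocks: "\<And>vs k \<theta> \<mu>. (vs, k, \<theta>, \<mu>) \<in> set T \<Longrightarrow> set vs \<subseteq> carrier_vec n \<and> length vs = k \<and>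
      (\<theta> = 1 \<or> \<theta> = -1) \<and> gram H vs = complex_of_real \<theta> \<cdot>\<^sub>m Q_mat k \<and>
      gram (H * A) vs = (complex_of_real \<theta> \<cdot>\<^sub>m Q_mat k) * jordan_block k \<mu>"
    and orth: "sorted_wrt (orthogonal_lists H) (map fst T)"
      "sorted_wrt (orthogonal_lists (H * A)) (map fst T)"
    and n: "sum_list (map fst kth) = n"
  shows "\<exists>P P'. P \<in> carrier_mat n n \<and> P' \<in> carrier_mat n n \<and> inverts_mat P P' \<and> inverts_mat P' P \<and>
    P' * A * P = jordan_matrix jbs \<and> mat_adjoint P * H * P = sign_matrix kth"
proof -
  let ?vs = "concat (map fst T)"
  define P where "P = mat_of_cols n ?vs"
  let ?S = "sign_matrix kth"
  have "map length (map fst T) = map fst kth"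
    using blocks unfolding kth_def by auto
  then have len: "length ?vs = n" using n unfolding length_concat by simp
  have sub: "set ?vs \<subseteq> carrier_vec n" using blocks by fastforce
  have P: "P \<in> carrier_mat n n" unfolding P_def using len by auto
  have Pa: "mat_adjoint P \<in> carrier_mat n n" by (rule mat_adjoint_carrier[OF P])
  have S: "?S \<in> carrier_mat n n" using sign_matrix_carrier[of kth] n by simp
  have K: "H * A \<in> carrier_mat n n" using H A by simp
  have "map (gram H) (map fst T) = map (\<lambda>(k, \<theta>). complex_of_real \<theta> \<cdot>\<^sub>m Q_mat k) kth"
    unfolding kth_def using blocks by auto
  then have PHP: "mat_adjoint P * H * P = ?S"
    unfolding P_def gram_congruence[OF H len sub] gram_concat[OF orth(1)] sign_matrix_def by simp
  have "map (gram (H * A)) (map fst T)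
      = map (\<lambda>(vs, k, \<theta>, \<mu>). (complex_of_real \<theta> \<cdot>\<^sub>m Q_mat k) * jordan_block k \<mu>) T"
    using blocks by auto
  then have "mat_adjoint P * (H * A) * P
      = diag_block_mat (map (\<lambda>(vs, k, \<theta>, \<mu>). (complex_of_real \<theta> \<cdot>\<^sub>m Q_mat k) * jordan_block k \<mu>) T)"
    unfolding P_def gram_congruence[OF K len sub] gram_concat[OF orth(2)]
    by (rule arg_cong)
  also have "\<dots> = diag_block_mat (map (\<lambda>(vs, k, \<theta>, \<mu>). complex_of_real \<theta> \<cdot>\<^sub>m Q_mat k) T)
      * diag_block_mat (map (\<lambda>(vs, k, \<theta>, \<mu>). jordan_block k \<mu>) T)"
    by (subst diag_block_mat_mult[where d = "\<lambda>(vs, k, \<theta>, \<mu>). k"]) (auto intro!: arg_cong[of _ _ diag_block_mat])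
  also have "diag_block_mat (map (\<lambda>(vs, k, \<theta>, \<mu>). complex_of_real \<theta> \<cdot>\<^sub>m Q_mat k) T) = ?S"
    unfolding sign_matrix_def kth_def by (simp add: o_def case_prod_unfold)
  also have "diag_block_mat (map (\<lambda>(vs, k, \<theta>, \<mu>). jordan_block k \<mu>) T) = jordan_matrix jbs"
    unfolding jordan_matrix_def jbs_def by (simp add: o_def case_prod_unfold)
  finally have PKP: "mat_adjoint P * (H * A) * P = ?S * jordan_matrix jbs" .
  have J: "jordan_matrix jbs \<in> carrier_mat n n"
  proof -
    have "map fst jbs = map fst kth" unfolding jbs_def kth_def by auto
    then show ?thesis using n by (intro carrier_matI) simp_all
  qed
  have SS: "?S * ?S = 1\<^sub>m n"
    using sign_matrix_involution[of kth] blocks n unfolding kth_def by fastforce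
  have PaH: "mat_adjoint P * H \<in> carrier_mat n n" by (rule mult_carrier_mat[OF Pa H])
  define P' where "P' = ?S * (mat_adjoint P * H)"
  have P': "P' \<in> carrier_mat n n" unfolding P'_def by (rule mult_carrier_mat[OF S PaH])
  have P'P: "P' * P = 1\<^sub>m n"
    unfolding P'_def assoc_mult_mat[OF S PaH P] PHP by (rule SS)
  then have PP': "P * P' = 1\<^sub>m n" by (rule mat_mult_left_right_inverse[OF P' P])
  have "P' * A = ?S * (mat_adjoint P * (H * A))"
    unfolding P'_def assoc_mult_mat[OF S PaH A] assoc_mult_mat[OF Pa H A] by (rule refl)
  then have "P' * A * P = ?S * (?S * jordan_matrix jbs)"
    using assoc_mult_mat[OF S mult_carrier_mat[OF Pa K] P] PKP by simp
  also have "\<dots> = jordan_matrix jbs"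
    unfolding assoc_mult_mat[OF S S J, symmetric] SS by (rule left_mult_one_mat[OF J])
  finally have "P' * A * P = jordan_matrix jbs" .
  then show ?thesis using P P' PP' P'P PHP unfolding inverts_mat_def by auto
qed

lemma sorted_wrt_map_upt:
  assumes "\<And>i j. i < j \<Longrightarrow> j < m \<Longrightarrow> R (f i) (f j)"
  shows "sorted_wrt R (map f [0..<m])"
  using assms by (simp add: sorted_wrt_iff_nth_less)

lemma smult_Q_mat_1: "c \<cdot>\<^sub>m Q_mat 1 = mat 1 1 (\<lambda>_. c)"
  by (intro eq_matI) (auto simp: Q_mat_def)

lemma orthogonal_to_pair:
  assumes M: "M \<in> carrier_mat n n" and v: "v \<in> carrier_vec n"
    and w: "w \<in> carrier_vec n" "w' \<in> carrier_vec n"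
    and "orthogonal_lists M [v] [w, w']"
  shows "orthogonal_lists M [v] [s \<cdot>\<^sub>v (w + (-1) \<cdot>\<^sub>v w'), s \<cdot>\<^sub>v (w + w')]"
  using assms by (simp add: orthogonal_lists_def indef_inner_linear[of _ n])

lemma orthogonal_pairs:
  assumes M: "M \<in> carrier_mat n n" and v: "v \<in> carrier_vec n" "v' \<in> carrier_vec n"
    and w: "w \<in> carrier_vec n" "w' \<in> carrier_vec n"
    and "orthogonal_lists M [v, v'] [w, w']"
  shows "orthogonal_lists M [s \<cdot>\<^sub>v (v + (-1) \<cdot>\<^sub>v v'), s \<cdot>\<^sub>v (v + v')]
    [s \<cdot>\<^sub>v (w + (-1) \<cdot>\<^sub>v w'), s \<cdot>\<^sub>v (w + w')]"
  using assms by (simp add: orthogonal_lists_def indef_inner_linear[of _ n])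

lemma gram_singleton: "gram M [v] = mat 1 1 (\<lambda>_. indef_inner M v v)"
  unfolding gram_def by (intro eq_matI) auto

lemma Q_jordan_1: "(c \<cdot>\<^sub>m Q_mat 1) * jordan_block 1 \<mu> = mat 1 1 (\<lambda>_. c * \<mu>)"
  by (intro eq_matI) (auto simp: Q_mat_def scalar_prod_def)

lemma Q_jordan_2: "(1 \<cdot>\<^sub>m Q_mat 2) * jordan_block 2 0 = mat 2 2 (\<lambda>(i, j). if i = 1 \<and> j = 1 then 1 else 0)"
  by (intro eq_matI) (auto simp: Q_mat_def scalar_prod_def less_2_cases_iff numeral_2_eq_2)

text \<open>The return from the orthonormal basis \<open>v, w\<close> of a hyperbolic plane to its chain. The first
  part is for \<open>h\<close>, the second for \<open>k\<close>.\<close>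

lemma chain_gram:
  assumes M: "M \<in> carrier_mat n n" and v: "v \<in> carrier_vec n" "w \<in> carrier_vec n"
    and s: "s * s = 1/2" "cnj s = s"
  defines "e1 \<equiv> s \<cdot>\<^sub>v (v + (-1) \<cdot>\<^sub>v w)" and "e2 \<equiv> s \<cdot>\<^sub>v (v + w)"
  shows "indef_inner M v v = 1 \<Longrightarrow> indef_inner M w w = -1 \<Longrightarrow> indef_inner M v w = 0 \<Longrightarrow>
      indef_inner M w v = 0 \<Longrightarrow> gram M [e1, e2] = 1 \<cdot>\<^sub>m Q_mat 2"
    and "indef_inner M v v = 1/2 \<Longrightarrow> indef_inner M w w = 1/2 \<Longrightarrow> indef_inner M v w = 1/2 \<Longrightarrow>
      indef_inner M w v = 1/2 \<Longrightarrow> gram M [e1, e2] = (1 \<cdot>\<^sub>m Q_mat 2) * jordan_block 2 0"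
proof -
  have ss: "s * (s * t) = t / 2" for t using s(1) by (simp flip: mult.assoc)
  have s2: "s * (2 * s) = 1" using s(1) by (simp add: mult_ac)
  have e: "indef_inner M e1 e1 = (indef_inner M v v - indef_inner M v w - indef_inner M w v + indef_inner M w w) / 2"
    "indef_inner M e1 e2 = (indef_inner M v v + indef_inner M v w - indef_inner M w v - indef_inner M w w) / 2"
    "indef_inner M e2 e1 = (indef_inner M v v - indef_inner M v w + indef_inner M w v - indef_inner M w w) / 2"
    "indef_inner M e2 e2 = (indef_inner M v v + indef_inner M v w + indef_inner M w v + indef_inner M w w) / 2"
    unfolding e1_def e2_def using M v
    by (simp_all add: indef_inner_linear[of _ n] s(2) ss ring_distribs) 
  show "gram M [e1, e2] = 1 \<cdot>\<^sub>m Q_mat 2"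
    if "indef_inner M v v = 1" "indef_inner M w w = -1" "indef_inner M v w = 0" "indef_inner M w v = 0"
    by (intro eq_matI) (auto simp: gram_def Q_mat_def e that less_Suc_eq add_is_1 numeral_2_eq_2)
  show "gram M [e1, e2] = (1 \<cdot>\<^sub>m Q_mat 2) * jordan_block 2 0"
    if "indef_inner M v v = 1/2" "indef_inner M w w = 1/2" "indef_inner M v w = 1/2" "indef_inner M w v = 1/2"
    unfolding Q_jordan_2
    by (intro eq_matI) (auto simp: gram_def e that less_Suc_eq numeral_2_eq_2)
qed

section \<open>The positive spectrum\<close>

definition diagonal :: "nat \<Rightarrow> (nat \<Rightarrow> complex) \<Rightarrow> complex mat" where
  "diagonal n d = mat n n (\<lambda>(i, j). if i = j then d i else 0)"

lemma diagonal_mult_vec: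
  assumes "x \<in> carrier_vec n" "i < n"
  shows "(diagonal n d *\<^sub>v x) $ i = d i * x $ i"
proof -
  have "(diagonal n d *\<^sub>v x) $ i = (\<Sum>l<n. (if i = l then d i else 0) * x $ l)"
    using assms by (auto simp: diagonal_def scalar_prod_def lessThan_atLeast0)
  also have "\<dots> = (\<Sum>l<n. if l = i then d i * x $ i else 0)" by (intro sum.cong) auto
  finally show ?thesis using assms by simp
qed

lemma jordan_matrix_diagonal: "jordan_matrix (map (\<lambda>i. (1, \<mu> i)) [0..<n]) = diagonal n \<mu>"
proof -
  have "map (\<lambda>(k, a). jordan_block k a) (map (\<lambda>i. (1, \<mu> i)) [0..<n])
      = map (\<lambda>i. mat 1 1 (\<lambda>_. \<mu> i)) [0..<n]"
    by (auto intro!: eq_matI)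
  then show ?thesis
    unfolding jordan_matrix_def diag_block_mat_diagonal diagonal_def
    by (simp only: diag_block_mat_diagonal) (auto intro!: eq_matI)
qed

lemma sign_matrix_diagonal:
  "sign_matrix (map (\<lambda>i. (1, \<theta> i)) [0..<n]) = diagonal n (\<lambda>i. complex_of_real (\<theta> i))"
proof -
  have "map (\<lambda>(k, \<theta>). complex_of_real \<theta> \<cdot>\<^sub>m Q_mat k) (map (\<lambda>i. (1, \<theta> i)) [0..<n])
      = map (\<lambda>i. mat 1 1 (\<lambda>_. complex_of_real (\<theta> i))) [0..<n]"
    by (auto intro!: eq_matI simp: Q_mat_def)
  then show ?thesis
    unfolding sign_matrix_def diagonal_def
    by (simp only: diag_block_mat_diagonal) (auto intro!: eq_matI)
qed

text \<open>Let \<open>w = A e\<^sub>a\<close>. Then \<open>B w = \<mu>\<^sub>a w\<close>, so \<open>w\<close>, and with it \<open>v = w - sqrt r e\<^sub>a\<close>, is supported on the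
  indices of the eigenvalue \<open>\<mu>\<^sub>a\<close>, where \<open>h\<close> is the Euclidean inner product. From
  \<open>A\<^sup>2 e\<^sub>a = r e\<^sub>a\<close> follows \<open>A v = - sqrt r v\<close>, and nonnegativity forces \<open>v = 0\<close>.\<close>

lemma eigenvector_of_nonneg_sqrt:
  assumes A: "A \<in> carrier_mat n n" "A * A = diagonal n \<mu>"
    and pos: "\<And>x. x \<in> carrier_vec n \<Longrightarrow> 0 \<le> indef_inner (diagonal n d) (A *\<^sub>v x) x"
    and a: "a < n" "\<mu> a = complex_of_real r" "r > 0"
    and d: "\<And>i. i < n \<Longrightarrow> \<mu> i = \<mu> a \<Longrightarrow> d i = 1"
  shows "A *\<^sub>v unit_vec n a = complex_of_real (sqrt r) \<cdot>\<^sub>v unit_vec n a"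
proof -
  let ?e = "unit_vec n a :: complex vec" and ?B = "diagonal n \<mu>" and ?s = "complex_of_real (sqrt r)"
  have e: "?e \<in> carrier_vec n" by simp
  have B: "?B \<in> carrier_mat n n" unfolding diagonal_def by simp
  define w where "w = A *\<^sub>v ?e"
  have w: "w \<in> carrier_vec n" unfolding w_def using A(1) by simp
  have Aw: "A *\<^sub>v w = ?B *\<^sub>v ?e"
    unfolding w_def A(2)[symmetric] assoc_mult_mat_vec[OF A(1) A(1) e] by (rule refl)
  have Be: "?B *\<^sub>v ?e = \<mu> a \<cdot>\<^sub>v ?e"
  proof (rule eq_vecI)
    fix i assume "i < dim_vec (\<mu> a \<cdot>\<^sub>v ?e)"
    then have i: "i < n" by simp
    then show "(?B *\<^sub>v ?e) $ i = (\<mu> a \<cdot>\<^sub>v ?e) $ i"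
      unfolding diagonal_mult_vec[OF e i] using a(1) by (auto simp: index_unit_vec)
  qed (use B in auto)
  have Bw: "?B *\<^sub>v w = \<mu> a \<cdot>\<^sub>v w"
  proof -
    have "?B *\<^sub>v w = A *\<^sub>v (A *\<^sub>v w)" unfolding A(2)[symmetric] by (rule assoc_mult_mat_vec[OF A(1) A(1) w])
    also have "\<dots> = A *\<^sub>v (\<mu> a \<cdot>\<^sub>v ?e)" unfolding Aw Be by (rule refl)
    also have "\<dots> = \<mu> a \<cdot>\<^sub>v w" unfolding w_def by (rule mult_mat_vec[OF A(1) e])
    finally show ?thesis .
  qed
  have w0: "w $ i = 0" if "i < n" "\<mu> i \<noteq> \<mu> a" for i
  proof -
    have "(?B *\<^sub>v w) $ i = (\<mu> a \<cdot>\<^sub>v w) $ i" using Bw by simp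
    then have "\<mu> i * w $ i = \<mu> a * w $ i" unfolding diagonal_mult_vec[OF w that(1)] using that w by simp
    then show ?thesis using that(2) by simp
  qed
  define v where "v = w + (- ?s) \<cdot>\<^sub>v ?e"
  have v: "v \<in> carrier_vec n" unfolding v_def using w by simp
  have ss: "?s * ?s = \<mu> a" unfolding a(2) using a(3) by (simp flip: of_real_mult)
  have "A *\<^sub>v v = A *\<^sub>v w + (- ?s) \<cdot>\<^sub>v w"
    unfolding v_def mult_add_distrib_mat_vec[OF A(1) w smult_carrier_vec[THEN iffD2, OF e]]
      mult_mat_vec[OF A(1) e] w_def[symmetric] by (rule refl)
  also have "\<dots> = (- ?s) \<cdot>\<^sub>v v"
    unfolding Aw Be v_def ss[symmetric] using w by (intro eq_vecI) (auto simp: algebra_simps)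
  finally have Av: "A *\<^sub>v v = (- ?s) \<cdot>\<^sub>v v" .
  have "diagonal n d *\<^sub>v v = v"
  proof (rule eq_vecI)
    fix i assume "i < dim_vec v"
    then have i: "i < n" using v by simp
    have "v $ i = 0" if "\<mu> i \<noteq> \<mu> a"
      using w0[OF i that] that i w unfolding v_def by (auto simp: unit_vec_def)
    then show "(diagonal n d *\<^sub>v v) $ i = v $ i"
      unfolding diagonal_mult_vec[OF v i] using d[OF i] by (cases "\<mu> i = \<mu> a") auto
  qed (use v in \<open>auto simp: diagonal_def\<close>)
  then have "indef_inner (diagonal n d) v v = v \<bullet>c v" unfolding indef_inner_def by simp
  moreover have "indef_inner (diagonal n d) (A *\<^sub>v v) v = - ?s * indef_inner (diagonal n d) v v"
    unfolding Av by (rule indef_inner_smult_left[OF _ v v]) (simp add: diagonal_def)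
  ultimately have "0 \<le> - ?s * (v \<bullet>c v)" using pos[OF v] by simp
  moreover have "0 \<le> v \<bullet>c v" by (rule conjugate_square_ge_0_vec)
  ultimately have "v \<bullet>c v = 0"
    using a(3) by (auto simp: less_eq_complex_def complex_eq_iff mult_le_0_iff zero_le_mult_iff)
  then have "v = 0\<^sub>v n" using conjugate_square_eq_0_vec[OF v] by simp
  then have "(w + (- ?s) \<cdot>\<^sub>v ?e) $ i = 0" if "i < n" for i using that unfolding v_def by simp
  then show ?thesis unfolding w_def[symmetric] using w by (intro eq_vecI) auto
qed

section \<open>The Segre pairing\<close>

lemma zero_block_sizes_canonical:
  assumes "\<And>i. i < q \<Longrightarrow> lam i > 0"
  shows "zero_block_sizes (map (\<lambda>i. (1, complex_of_real (lam i))) [0..<q] @ map (\<lambda>i. (1, 0)) [0..<s])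
    = replicate s 1"
proof -
  have "filter (\<lambda>(k, a). a = 0) (map (\<lambda>i. (1 :: nat, complex_of_real (lam i))) [0..<q]) = []"
    using assms by (fastforce simp: filter_empty_conv)
  moreover have "filter (\<lambda>(k, a). a = 0) (map (\<lambda>i. (1 :: nat, 0 :: complex)) [0..<s])
      = map (\<lambda>i. (1, 0)) [0..<s]"
    by (auto simp: filter_id_conv)
  ultimately show ?thesis
    unfolding zero_block_sizes_def by (simp add: o_def map_replicate_const)
qed

abbreviation standard_pairing :: "nat \<Rightarrow> nat \<Rightarrow> (nat \<times> nat) list" where
  "standard_pairing l1 l2 \<equiv> replicate l1 (1, 0) @ replicate l2 (1, 1)"

lemma count_replicate: "count_list (replicate m x) y = (if x = y then m else 0)"
  by (induction m) auto

lemma standard_pairing_counts: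
  "count_list (standard_pairing l1 l2) (1, 0) = l1" "count_list (standard_pairing l1 l2) (1, 1) = l2"
  by (simp_all add: count_replicate)

lemma standard_pairing_sorted: "sorted_wrt lex_le (standard_pairing l1 l2)"
  by (auto simp: sorted_wrt_iff_nth_less nth_append lex_le_def)

lemma single_pos_standard_pairing:
  assumes "i < l1"
  shows "single_pos (standard_pairing l1 l2) i = i"
proof -
  let ?S = "standard_pairing l1 l2"
  have "[0..<length ?S] = [0..<l1] @ [l1..<l1 + l2]" using upt_add_eq_append[of 0 l1 l2] by simp
  moreover have "filter (\<lambda>k. ?S ! k = (1, 0)) [0..<l1] = [0..<l1]"
    by (auto simp: filter_id_conv nth_append)
  moreover have "filter (\<lambda>k. ?S ! k = (1, 0)) [l1..<l1 + l2] = []"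
    by (auto simp: filter_empty_conv nth_append)
  ultimately have "filter (\<lambda>k. ?S ! k = (1, 0)) [0..<length ?S] = [0..<l1]"
    by (simp only: filter_append append_Nil2)
  then show ?thesis using assms unfolding single_pos_def by simp
qed

lemma slots_standard_pairing:
  "slots (standard_pairing l1 l2) = {..<l1 + l2} \<times> {0} \<union> {l1..<l1 + l2} \<times> {1}"
  by (auto simp: slots_def slot_entry_def nth_append less_Suc_eq numeral_2_eq_2 split: if_splits)

text \<open>The enumeration lists first the blocks in the pairs (1,0), then the first and
  then the second members of the pairs (1,1), so that a slot (k,0) is at position \<open>k\<close> and
  a slot (k,1) at position \<open>k + l2\<close>.\<close>

lemma segre_assignment_of_enumeration:
  assumes zs: "distinct zs" "set zs = {..<s}" "length zs = l1 + 2 * l2"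
    and sizes: "zero_block_sizes bs = replicate s 1"
  shows "segre_assignment bs (standard_pairing l1 l2) (\<lambda>(k, c). zs ! (if c = 0 then k else k + l2))"
proof -
  let ?S = "standard_pairing l1 l2"
  let ?pos = "\<lambda>(k, c). if c = (0 :: nat) then k else k + l2"
  have "bij_betw ?pos (slots ?S) {..<length zs}"
    unfolding slots_standard_pairing
  proof (rule bij_betw_byWitness[where f' = "\<lambda>p. if p < l1 + l2 then (p, 0) else (p - l2, 1)"])
  qed (auto simp: zs(3))
  moreover have "bij_betw ((!) zs) {..<length zs} {..<s}"
    using zs by (intro bij_betw_nth) auto
  ultimately have "bij_betw ((!) zs \<circ> ?pos) (slots ?S) {..<s}" by (rule bij_betw_trans)
  moreover have "(!) zs \<circ> ?pos = (\<lambda>(k, c). zs ! (if c = 0 then k else k + l2))" by auto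
  ultimately have bij: "bij_betw (\<lambda>(k, c). zs ! (if c = 0 then k else k + l2)) (slots ?S) {..<s}" by simp
  have "slot_entry ?S t = 1" if "t \<in> slots ?S" for t
    using that unfolding slots_standard_pairing by (auto simp: slot_entry_def nth_append)
  moreover have "(case t of (k, c) \<Rightarrow> zs ! (if c = 0 then k else k + l2)) < s" if "t \<in> slots ?S" for t
    using bij_betwE[OF bij] that by auto
  ultimately show ?thesis
    unfolding segre_assignment_def using bij by (auto simp: sizes)
qed

section \<open>Nonnegative square roots in canonical form\<close>

theorem theorem5p4:
  fixes H B A :: "complex mat" and n q s :: nat
    and lam \<epsilon> :: "nat \<Rightarrow> real" and bs :: "(nat \<times> complex) list"
  assumes H: "H \<in> carrier_mat n n" "invertible_mat H" "mat_adjoint H = H"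
    and B: "B \<in> carrier_mat n n" "H_nonneg H B"
    and no_neg: "\<And>r :: real. r < 0 \<Longrightarrow> \<not> eigenvalue B (complex_of_real r)"
    and no_J2: "\<And>cs. jordan_nf B cs \<Longrightarrow> (2, 0) \<notin> set cs"
    and lam: "\<And>i. i < q \<Longrightarrow> lam i > 0"
    and eps: "\<And>i. i < s \<Longrightarrow> \<epsilon> i = 1 \<or> \<epsilon> i = -1"
    and bs: "bs = map (\<lambda>i. (1, complex_of_real (lam i))) [0..<q] @ map (\<lambda>i. (1, 0)) [0..<s]"
    and B_canonical: "B = jordan_matrix bs"
    and H_canonical: "H = sign_matrix (map (\<lambda>i. (1, 1)) [0..<q] @ map (\<lambda>i. (1, \<epsilon> i)) [0..<s])"
    and A: "H_nonneg_sqrt H B A"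
  shows "\<exists>S \<sigma> \<iota> \<zeta> l1 l2 P P'.
    segre_pairing B S \<and> segre_assignment bs S \<sigma> \<and>
    l1 = count_list S (1, 0) \<and> l2 = count_list S (1, 1) \<and>
    P \<in> carrier_mat n n \<and> P' \<in> carrier_mat n n \<and> inverts_mat P P' \<and> inverts_mat P' P \<and>
    P' * A * P = jordan_matrix (map (\<lambda>i. (1, complex_of_real (sqrt (lam i)))) [0..<q]
                   @ map (\<lambda>i. (1, 0)) [0..<l1] @ map (\<lambda>i. (2, 0)) [0..<l2]) \<and>
    mat_adjoint P * H * P = sign_matrix (map (\<lambda>i. (1, 1)) [0..<q]
                   @ map (\<lambda>i. (1, \<zeta> i)) [0..<l1] @ map (\<lambda>i. (2, 1)) [0..<l2]) \<and>
    inj_on \<iota> {..<l1} \<and> \<iota> ` {..<l1} \<subseteq> {..<s} \<and>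
    (\<forall>i<l1. \<iota> i = \<sigma> (single_pos S i, 0) \<and> \<zeta> i = \<epsilon> (\<iota> i))"
proof -
  let ?h = "indef_inner H" and ?k = "indef_inner (H * A)"
  let ?e = "unit_vec n :: nat \<Rightarrow> complex vec"
  define sg where "sg a = (if a < q then 1 else \<epsilon> (a - q))" for a
  define \<mu> where "\<mu> a = (if a < q then complex_of_real (lam a) else 0)" for a
  have shift: "map f [0..<q] @ map g [0..<s] = map (\<lambda>a. if a < q then f a else g (a - q)) [0..<q + s]"
    for f g :: "nat \<Rightarrow> 'b"
    by (rule nth_equalityI) (auto simp: nth_append)
  have H_diag: "H = diagonal (q + s) (\<lambda>a. complex_of_real (sg a))"
  proof -
    have "map (\<lambda>i. (1 :: nat, 1 :: real)) [0..<q] @ map (\<lambda>i. (1, \<epsilon> i)) [0..<s]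
        = map (\<lambda>a. (1, sg a)) [0..<q + s]"
      unfolding shift sg_def by auto
    then show ?thesis unfolding H_canonical by (simp only: sign_matrix_diagonal)
  qed
  have n: "n = q + s" using H(1) unfolding H_diag diagonal_def by auto
  have bs_eq: "bs = map (\<lambda>a. (1, \<mu> a)) [0..<n]"
    unfolding bs shift \<mu>_def n by auto
  have B_diag: "B = diagonal n \<mu>" unfolding B_canonical bs_eq by (rule jordan_matrix_diagonal)
  note H_diag = H_diag[folded n]
  have sg: "sg a = 1 \<or> sg a = -1" if "a < n" for a using eps[of "a - q"] that n unfolding sg_def by auto
  have Ac: "A \<in> carrier_mat n n" and nonneg: "\<And>x. x \<in> carrier_vec n \<Longrightarrow> 0 \<le> ?h (A *\<^sub>v x) x"
    using A H(1) unfolding H_nonneg_sqrt_def H_nonneg_def by auto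
  have AA: "A * A = B"
    using A Ac unfolding H_nonneg_sqrt_def by (simp add: numeral_2_eq_2)
  have K: "H * A \<in> carrier_mat n n" using H(1) Ac by simp
  have k_h: "?k x y = ?h (A *\<^sub>v x) y" if "x \<in> carrier_vec n" for x y
    by (rule indef_inner_mult_mat[OF H(1) Ac that])
  have pos: "pos_form n (H * A)" unfolding pos_form_def using K nonneg k_h by auto
  have ec: "?e a \<in> carrier_vec n" for a by simp
  have h_e: "?h x (?e b) = complex_of_real (sg b) * x $ b" if "x \<in> carrier_vec n" "b < n" for x b
    unfolding indef_inner_unit_right[OF H(1) that] unfolding H_diag
    by (rule diagonal_mult_vec[OF that])
  have frame_e: "frame n H sg ?e" unfolding frame_def using h_e[OF ec] by auto
  have Ae: "A *\<^sub>v ?e a = complex_of_real (sqrt (lam a)) \<cdot>\<^sub>v ?e a" if a: "a < q" for a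
  proof (rule eigenvector_of_nonneg_sqrt[OF Ac AA[unfolded B_diag] nonneg[unfolded H_diag]])
    show "\<mu> a = complex_of_real (lam a)" "lam a > 0" "a < n" using a lam n unfolding \<mu>_def by auto
    fix i assume "\<mu> i = \<mu> a"
    then have "i < q" using a lam[of a] unfolding \<mu>_def by (auto split: if_splits)
    then show "complex_of_real (sg i) = 1" unfolding sg_def by simp
  qed
  have ke: "?k (?e a) y = complex_of_real (sqrt (lam a)) * ?h (?e a) y"
    if "a < q" "y \<in> carrier_vec n" for a y
    unfolding k_h[OF ec] Ae[OF that(1)] by (rule indef_inner_smult_left[OF H(1) ec that(2)])
  define I where "I = {q..<n}"
  have I: "I \<subseteq> {..<n}" and nI: "{..<n} - I = {..<q}" unfolding I_def n by auto
  have dec: "?k (?e a) (?e b) = 0" if "a \<in> I" "b \<in> {..<n} - I" for a b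
  proof -
    have b: "b < q" "b < n" "a < n" "b \<noteq> a" using that I_def by auto
    have "?k (?e b) (?e a) = 0" unfolding ke[OF b(1) ec] frame_inner[OF frame_e b(2,3)] using b by simp
    then show ?thesis using pos_form_hermitian[OF pos ec ec, of a b] by simp
  qed
  have AAx: "A *\<^sub>v (A *\<^sub>v x) = 0\<^sub>v n"
    if x: "x \<in> carrier_vec n" and orth: "\<And>b. b \<in> {..<q} \<Longrightarrow> ?h x (?e b) = 0" for x
  proof (rule eq_vecI)
    fix i assume "i < dim_vec (0\<^sub>v n :: complex vec)"
    then have i: "i < n" by simp
    have "A *\<^sub>v (A *\<^sub>v x) = B *\<^sub>v x" unfolding AA[symmetric] using assoc_mult_mat_vec[OF Ac Ac x] by simp
    then have "(A *\<^sub>v (A *\<^sub>v x)) $ i = \<mu> i * x $ i" unfolding B_diag using diagonal_mult_vec[OF x i] by simp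
    also have "\<dots> = 0" using orth[of i] h_e[OF x i] sg[OF i] unfolding \<mu>_def by auto
    finally show "(A *\<^sub>v (A *\<^sub>v x)) $ i = 0\<^sub>v n $ i" using i by simp
  qed (use Ac in auto)
  have "\<exists>g ps xs. frame n H sg g \<and> (\<forall>b \<in> {..<n} - I. g b = ?e b) \<and>
    distinct (xs @ map fst ps @ map snd ps) \<and> set (xs @ map fst ps @ map snd ps) = I \<and>
    (\<forall>(i, j) \<in> set ps. sg i = 1 \<and> sg j = -1 \<and>
       (\<forall>a \<in> {i, j}. \<forall>b \<in> {i, j}. ?k (g a) (g b) = 1/2) \<and>
       (\<forall>a \<in> {i, j}. \<forall>b \<in> {..<n} - {i, j}. ?k (g a) (g b) = 0)) \<and>
    (\<forall>a \<in> set xs. \<forall>b<n. ?k (g a) (g b) = 0)"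
    by (rule hyperbolic_frame_exists[where D = "{..<q}" and d = ?e,
          OF H(1) H(3) Ac pos sg I frame_e dec AAx]) (simp_all add: nI)
  then obtain g ps xs where g: "frame n H sg g" and g_e: "\<forall>b \<in> {..<n} - I. g b = ?e b"
    and dist: "distinct (xs @ map fst ps @ map snd ps)"
    and set_I: "set (xs @ map fst ps @ map snd ps) = I"
    and ps: "\<forall>(i, j) \<in> set ps. sg i = 1 \<and> sg j = -1 \<and>
       (\<forall>a \<in> {i, j}. \<forall>b \<in> {i, j}. ?k (g a) (g b) = 1/2) \<and>
       (\<forall>a \<in> {i, j}. \<forall>b \<in> {..<n} - {i, j}. ?k (g a) (g b) = 0)"
    and xs: "\<forall>a \<in> set xs. \<forall>b<n. ?k (g a) (g b) = 0"
    by (elim exE conjE) (rule that)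
  have gc: "g a \<in> carrier_vec n" if "a < n" for a using g that by (rule frame_carrier)
  define l1 where "l1 = length xs"
  define l2 where "l2 = length ps"
  define p where "p i = fst (ps ! i)" for i
  define r where "r i = snd (ps ! i)" for i
  have pr: "(p i, r i) \<in> set ps" if "i < l2" for i
    using that unfolding p_def r_def l2_def by simp
  have pr_sg: "sg (p i) = 1" "sg (r i) = -1"
    and pr_k: "\<And>a b. a \<in> {p i, r i} \<Longrightarrow> b \<in> {p i, r i} \<Longrightarrow> ?k (g a) (g b) = 1/2"
    and pr_0: "\<And>a b. a \<in> {p i, r i} \<Longrightarrow> b \<in> {..<n} - {p i, r i} \<Longrightarrow> ?k (g a) (g b) = 0"
    if "i < l2" for i
    using bspec[OF ps pr[OF that]] by auto
  have xs_I: "xs ! i \<in> I" if "i < l1" for i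
    using that nth_mem[of i xs] unfolding l1_def set_I[symmetric] by simp
  have pr_I: "p i \<in> I" "r i \<in> I" if "i < l2" for i
    using imageI[OF pr[OF that], of fst] imageI[OF pr[OF that], of snd]
    unfolding set_I[symmetric] by simp_all
  have I_iff: "a \<in> I \<longleftrightarrow> q \<le> a \<and> a < n" for a unfolding I_def by auto
  have ne_xs: "xs ! i \<noteq> xs ! j" if "i < j" "j < l1" for i j
    using dist that unfolding l1_def by (auto simp: nth_eq_iff_index_eq)
  have ne_pr: "p i \<noteq> p j" "r i \<noteq> r j" if "i < j" "j < l2" for i j
    using dist that nth_eq_iff_index_eq[of "map fst ps" i j] nth_eq_iff_index_eq[of "map snd ps" i j]
    unfolding l2_def p_def r_def by auto
  have p_r: "p i \<noteq> r j" if "i < l2" "j < l2" for i j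
    using pr_sg(1)[OF that(1)] pr_sg(2)[OF that(2)] by auto
  have xs_pr: "xs ! i \<noteq> p j" "xs ! i \<noteq> r j" if "i < l1" "j < l2" for i j
  proof -
    have "xs ! i \<in> set xs" "p j \<in> fst ` set ps" "r j \<in> snd ` set ps"
      using that(1) imageI[OF pr[OF that(2)], of fst] imageI[OF pr[OF that(2)], of snd]
      unfolding l1_def by simp_all
    moreover have "set xs \<inter> fst ` set ps = {}" "set xs \<inter> snd ` set ps = {}" using dist by auto
    ultimately show "xs ! i \<noteq> p j" "xs ! i \<noteq> r j" by (metis disjoint_iff)+
  qed
  \<comment> \<open>the blocks of \<open>B\<close> at 0 are numbered from 0, the basis vectors from \<open>q\<close>\<close>
  define \<sigma> :: "nat \<times> nat \<Rightarrow> nat"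
    where "\<sigma> = (\<lambda>(k, c). map (\<lambda>x. x - q) (xs @ map fst ps @ map snd ps) ! (if c = 0 then k else k + l2))"
  define \<iota> where "\<iota> i = xs ! i - q" for i
  define \<zeta> where "\<zeta> i = \<epsilon> (\<iota> i)" for i
  have \<zeta>: "\<zeta> i = sg (xs ! i)" if "i < l1" for i
    using xs_I[OF that] unfolding \<zeta>_def \<iota>_def sg_def I_iff by auto

  let ?zs = "map (\<lambda>x. x - q) (xs @ map fst ps @ map snd ps)"
  have zs: "distinct ?zs" "set ?zs = {..<s}"
  proof -
    have "inj_on (\<lambda>x. x - q) I" by (intro inj_onI) (auto simp: I_iff)
    then show "distinct ?zs" unfolding distinct_map set_I using dist by simp
    have "(\<lambda>x. x - q) ` I = {..<s}"
    proof (intro equalityI subsetI)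
      fix y assume "y \<in> {..<s}"
      then have "y + q \<in> I" "y = (y + q) - q" by (auto simp: I_iff n)
      then show "y \<in> (\<lambda>x. x - q) ` I" by (rule rev_image_eqI)
    qed (auto simp: I_iff n)
    then show "set ?zs = {..<s}" unfolding set_map set_I by simp
  qed
  have len: "length ?zs = l1 + 2 * l2" unfolding l1_def l2_def by simp
  have s_eq: "s = l1 + 2 * l2" using distinct_card[OF zs(1)] zs(2) len by simp
  have assignment: "segre_assignment bs (standard_pairing l1 l2) \<sigma>"
    unfolding \<sigma>_def
    by (rule segre_assignment_of_enumeration[OF zs len]) (simp only: bs zero_block_sizes_canonical[OF lam])
  have "jordan_nf B bs"
    unfolding jordan_nf_def B_canonical[symmetric] using similar_mat_refl[OF B(1)]
    by (auto simp: bs)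
  then have pairing: "segre_pairing B (standard_pairing l1 l2)"
    unfolding segre_pairing_def using assignment standard_pairing_sorted by auto
  have \<sigma>_\<iota>: "\<sigma> (i, 0) = \<iota> i" if "i < l1" for i
    using that unfolding \<sigma>_def \<iota>_def l1_def by (simp add: nth_append)
  have \<iota>: "inj_on \<iota> {..<l1}" "\<iota> ` {..<l1} \<subseteq> {..<s}"
  proof -
    show "inj_on \<iota> {..<l1}"
    proof (rule inj_onI)
      fix i j assume ij: "i \<in> {..<l1}" "j \<in> {..<l1}" "\<iota> i = \<iota> j"
      then have "xs ! i = xs ! j" using xs_I[of i] xs_I[of j] unfolding \<iota>_def I_iff by auto
      then show "i = j" using ij ne_xs[of i j] ne_xs[of j i] by (cases i j rule: linorder_cases) auto
    qed
    show "\<iota> ` {..<l1} \<subseteq> {..<s}" using xs_I unfolding \<iota>_def I_iff n by fastforce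
  qed

  \<comment> \<open>\<open>h\<close> and \<open>k\<close> both vanish on different basis vectors except, for \<open>k\<close>, within a pair;
     the orthogonality of all blocks reduces to this\<close>
  have zero_k: "?k (g a) (g b) = 0"
    if ab: "a < n" "b < n" "a \<noteq> b" and not_pair: "\<And>i. i < l2 \<Longrightarrow> {a, b} \<noteq> {p i, r i}" for a b
  proof -
    consider "a < q" | "a \<in> set xs" | i where "i < l2" "a \<in> {p i, r i}"
    proof -
      have "a < q \<or> a \<in> set (xs @ map fst ps @ map snd ps)" using ab(1) unfolding set_I I_iff by auto
      then consider "a < q" | "a \<in> set xs" | "a \<in> set (map fst ps)" | "a \<in> set (map snd ps)" by auto
      then show thesis
      proof cases
        case 3
        then obtain i where "i < length ps" "a = fst (ps ! i)" by (auto simp: in_set_conv_nth)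
        then show thesis using that(3)[of i] unfolding l2_def p_def by simp
      next
        case 4
        then obtain i where "i < length ps" "a = snd (ps ! i)" by (auto simp: in_set_conv_nth)
        then show thesis using that(3)[of i] unfolding l2_def r_def by simp
      qed (use that in auto)
    qed
    then show ?thesis
    proof cases
      case 1
      then have "g a = ?e a" using g_e nI by auto
      then show ?thesis using ke[OF 1 gc[OF ab(2)]] frame_inner[OF g ab(1,2)] ab(3) by simp
    next
      case 2
      then show ?thesis using xs ab(2) by blast
    next
      case (3 i)
      then have "b \<in> {..<n} - {p i, r i}" using not_pair[OF 3(1)] ab by auto
      then show ?thesis by (rule pr_0[OF 3])
    qed
  qed
  have orth: "orthogonal_lists M [g a] [g b]"
    if "M \<in> {H, H * A}" "a < n" "b < n" "a \<noteq> b" "\<And>i. i < l2 \<Longrightarrow> {a, b} \<noteq> {p i, r i}" for M a b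
    using that zero_k[of a b] zero_k[of b a] frame_inner[OF g, of a b] frame_inner[OF g, of b a]
    by (auto simp: orthogonal_lists_def insert_commute)
  define c where "c = complex_of_real (1 / sqrt 2)"
  have c: "c * c = 1/2" "cnj c = c" unfolding c_def by (simp_all flip: of_real_mult)
  define ch where "ch i = [c \<cdot>\<^sub>v (g (p i) + (-1) \<cdot>\<^sub>v g (r i)), c \<cdot>\<^sub>v (g (p i) + g (r i))]" for i
  define T :: "(complex vec list \<times> nat \<times> real \<times> complex) list" where
    "T = map (\<lambda>i. ([g i], 1, 1, complex_of_real (sqrt (lam i)))) [0..<q]
      @ map (\<lambda>i. ([g (xs ! i)], 1, \<zeta> i, 0)) [0..<l1] @ map (\<lambda>i. (ch i, 2, 1, 0)) [0..<l2]"
  have bound: "\<And>i. i < q \<Longrightarrow> i < n" "\<And>i. i < l1 \<Longrightarrow> xs ! i < n"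
    "\<And>i. i < l2 \<Longrightarrow> p i < n" "\<And>i. i < l2 \<Longrightarrow> r i < n"
    using xs_I pr_I n by (auto simp: I_iff)
  have low: "\<And>i. i < l1 \<Longrightarrow> q \<le> xs ! i" "\<And>i. i < l2 \<Longrightarrow> q \<le> p i" "\<And>i. i < l2 \<Longrightarrow> q \<le> r i"
    using xs_I pr_I by (auto simp: I_iff)
  have orth_ch: "orthogonal_lists M [g a] (ch j)"
    if M: "M \<in> {H, H * A}" and a: "a < n" "\<And>i. i < l2 \<Longrightarrow> a \<noteq> p i \<and> a \<noteq> r i" and j: "j < l2" for M a j
  proof -
    have "orthogonal_lists M [g a] [g b]" if "b \<in> {p j, r j}" for b
      using a(2) j that bound by (intro orth[OF M a(1)]) (auto simp: doubleton_eq_iff)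
    then have "orthogonal_lists M [g a] [g (p j), g (r j)]" by (auto simp: orthogonal_lists_def)
    then show ?thesis unfolding ch_def using M H(1) K a(1) bound j gc
      by (intro orthogonal_to_pair[of _ n]) auto
  qed
  have ch_ch: "orthogonal_lists M (ch i) (ch j)" if M: "M \<in> {H, H * A}" and ij: "i < j" "j < l2" for M i j
  proof -
    have il: "i < l2" using ij by simp
    have "orthogonal_lists M [g a] [g b]" if a: "a \<in> {p i, r i}" and b: "b \<in> {p j, r j}" for a b
    proof (rule orth[OF M])
      show "a < n" "b < n" using a b bound il ij(2) by auto
      show "a \<noteq> b" using a b ne_pr[OF ij] p_r[OF il ij(2)] p_r[OF ij(2) il] by auto
      fix k assume k: "k < l2"
      have "k = i" if "a \<in> {p k, r k}"
        using a that ne_pr[of i k] ne_pr[of k i] p_r[OF il k] p_r[OF k il] il k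
        by (cases i k rule: linorder_cases) auto
      moreover have "k = j" if "b \<in> {p k, r k}"
        using b that ne_pr[of j k] ne_pr[of k j] p_r[OF ij(2) k] p_r[OF k ij(2)] ij(2) k
        by (cases j k rule: linorder_cases) auto
      ultimately show "{a, b} \<noteq> {p k, r k}" using ij(1) by auto
    qed
    then have "orthogonal_lists M [g (p i), g (r i)] [g (p j), g (r j)]"
      by (auto simp: orthogonal_lists_def)
    then show ?thesis unfolding ch_def using M H(1) K bound il ij(2) gc
      by (intro orthogonal_pairs[of _ n]) auto
  qed
  have single: "{a, b} \<noteq> {p k, r k}" if "k < l2" "\<And>k. k < l2 \<Longrightarrow> a \<noteq> p k \<and> a \<noteq> r k" for a b k
    using that by (auto simp: doubleton_eq_iff)
  have q_pr: "a \<noteq> p k \<and> a \<noteq> r k" if "a < q" "k < l2" for a k using that low by fastforce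
  have sorted_T: "sorted_wrt (orthogonal_lists M) (map fst T)" if M: "M \<in> {H, H * A}" for M
  proof -
    have "map fst T = map (\<lambda>i. [g i]) [0..<q] @ map (\<lambda>i. [g (xs ! i)]) [0..<l1] @ map ch [0..<l2]"
      unfolding T_def by (simp add: o_def)
    moreover have "sorted_wrt (orthogonal_lists M) (map (\<lambda>i. [g i]) [0..<q])"
      using bound single q_pr by (intro sorted_wrt_map_upt orth[OF M]) auto
    moreover have "sorted_wrt (orthogonal_lists M) (map (\<lambda>i. [g (xs ! i)]) [0..<l1])"
      using bound single xs_pr ne_xs by (intro sorted_wrt_map_upt orth[OF M]) auto
    moreover have "sorted_wrt (orthogonal_lists M) (map ch [0..<l2])"
      using ch_ch[OF M] by (intro sorted_wrt_map_upt)
    moreover have "orthogonal_lists M [g i] [g (xs ! j)]" if "i < q" "j < l1" for i j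
      using that bound low(1)[OF that(2)] single q_pr by (intro orth[OF M]) auto
    moreover have "orthogonal_lists M [g i] (ch j)" if "i < q" "j < l2" for i j
      using that bound q_pr by (intro orth_ch[OF M]) auto
    moreover have "orthogonal_lists M [g (xs ! i)] (ch j)" if "i < l1" "j < l2" for i j
      using that bound xs_pr by (intro orth_ch[OF M]) auto
    ultimately show ?thesis by (auto simp: sorted_wrt_append)
  qed
  have ch_block: "set (ch i) \<subseteq> carrier_vec n \<and> length (ch i) = 2 \<and>
      gram H (ch i) = 1 \<cdot>\<^sub>m Q_mat 2 \<and> gram (H * A) (ch i) = (1 \<cdot>\<^sub>m Q_mat 2) * jordan_block 2 0"
    if i: "i < l2" for i
  proof -
    note b = bound(3)[OF i] bound(4)[OF i]
    have "gram H (ch i) = 1 \<cdot>\<^sub>m Q_mat 2"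
      unfolding ch_def
      by (rule chain_gram(1)[OF H(1) gc[OF b(1)] gc[OF b(2)] c])
        (use b pr_sg[OF i] p_r[OF i i] in \<open>simp_all add: frame_inner[OF g]\<close>)
    moreover have "gram (H * A) (ch i) = (1 \<cdot>\<^sub>m Q_mat 2) * jordan_block 2 0"
      unfolding ch_def
      by (rule chain_gram(2)[OF K gc[OF b(1)] gc[OF b(2)] c]) (simp_all add: pr_k[OF i])
    ultimately show ?thesis unfolding ch_def using gc[OF b(1)] gc[OF b(2)] by simp
  qed
  have blocks: "set vs \<subseteq> carrier_vec n \<and> length vs = k \<and> (\<theta> = 1 \<or> \<theta> = -1) \<and>
      gram H vs = complex_of_real \<theta> \<cdot>\<^sub>m Q_mat k \<and>
      gram (H * A) vs = (complex_of_real \<theta> \<cdot>\<^sub>m Q_mat k) * jordan_block k \<nu>"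
    if "(vs, k, \<theta>, \<nu>) \<in> set T" for vs k \<theta> \<nu>
  proof -
    have one: "set [g a] \<subseteq> carrier_vec n \<and> length [g a] = 1 \<and> (sg a = 1 \<or> sg a = -1) \<and>
      gram H [g a] = complex_of_real (sg a) \<cdot>\<^sub>m Q_mat 1 \<and>
      gram (H * A) [g a] = (complex_of_real (sg a) \<cdot>\<^sub>m Q_mat 1) * jordan_block 1 \<nu>"
      if "a < n" "?k (g a) (g a) = complex_of_real (sg a) * \<nu>" for a \<nu>
      unfolding gram_singleton Q_jordan_1 unfolding smult_Q_mat_1
      using that gc sg frame_inner[OF g that(1) that(1)] by simp
    from that consider
      i where "i < q" "vs = [g i]" "k = 1" "\<theta> = 1" "\<nu> = complex_of_real (sqrt (lam i))" |
      i where "i < l1" "vs = [g (xs ! i)]" "k = 1" "\<theta> = \<zeta> i" "\<nu> = 0" |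
      i where "i < l2" "vs = ch i" "k = 2" "\<theta> = 1" "\<nu> = 0"
      unfolding T_def by auto
    then show ?thesis
    proof cases
      case (1 i)
      have "g i = ?e i" using 1(1) g_e nI by auto
      then have k: "?k (g i) (g i) = complex_of_real (sg i) * \<nu>"
        using ke[OF 1(1) ec] frame_inner[OF frame_e bound(1)[OF 1(1)] bound(1)[OF 1(1)]] 1(5) by simp
      have \<theta>: "\<theta> = sg i" using 1(1,4) unfolding sg_def by simp
      show ?thesis unfolding 1(2,3) \<theta> by (rule one[OF bound(1)[OF 1(1)] k])
    next
      case (2 i)
      have k: "?k (g (xs ! i)) (g (xs ! i)) = complex_of_real (sg (xs ! i)) * \<nu>"
        using xs nth_mem[of i xs] 2(1,5) bound(2)[OF 2(1)] unfolding l1_def by simp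
      show ?thesis unfolding 2(2,3,4) \<zeta>[OF 2(1)] by (rule one[OF bound(2)[OF 2(1)] k])
    next
      case (3 i)
      then show ?thesis using ch_block[OF 3(1)] by simp
    qed
  qed
  have kth: "map (\<lambda>(vs, k, \<theta>, \<mu>). (k, \<theta>)) T = map (\<lambda>i. (1, 1)) [0..<q]
      @ map (\<lambda>i. (1, \<zeta> i)) [0..<l1] @ map (\<lambda>i. (2, 1)) [0..<l2]"
    and jbs: "map (\<lambda>(vs, k, \<theta>, \<mu>). (k, \<mu>)) T = map (\<lambda>i. (1, complex_of_real (sqrt (lam i)))) [0..<q]
      @ map (\<lambda>i. (1, 0)) [0..<l1] @ map (\<lambda>i. (2, 0)) [0..<l2]"
    unfolding T_def by (simp_all add: o_def)
  have size: "sum_list (map fst (map (\<lambda>(vs, k, \<theta>, \<mu>). (k, \<theta>)) T)) = n"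
    unfolding kth n s_eq by (simp add: o_def sum_list_triv)
  obtain P P' where P: "P \<in> carrier_mat n n" "P' \<in> carrier_mat n n" "inverts_mat P P'" "inverts_mat P' P"
    and PA: "P' * A * P = jordan_matrix (map (\<lambda>(vs, k, \<theta>, \<mu>). (k, \<mu>)) T)"
    and PH: "mat_adjoint P * H * P = sign_matrix (map (\<lambda>(vs, k, \<theta>, \<mu>). (k, \<theta>)) T)"
    using canonical_form_of_chains[OF H(1) Ac blocks sorted_T sorted_T size] by blast
  have single_\<sigma>: "\<forall>i<l1. \<iota> i = \<sigma> (single_pos (standard_pairing l1 l2) i, 0) \<and> \<zeta> i = \<epsilon> (\<iota> i)"
    using single_pos_standard_pairing \<sigma>_\<iota> \<zeta>_def by simp
  show ?thesis
    by (rule exI[of _ "standard_pairing l1 l2"], rule exI[of _ \<sigma>], rule exI[of _ \<iota>], rule exI[of _ \<zeta>],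
        rule exI[of _ l1], rule exI[of _ l2], rule exI[of _ P], rule exI[of _ P'], intro conjI)
      (use pairing assignment standard_pairing_counts P PA[unfolded jbs] PH[unfolded kth] \<iota> single_\<sigma>
        in \<open>simp_all only:\<close>)
qed

end
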